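(* For every $m\geq 1$ there exists a constant $R_{1,m}^{\ast}<\infty$, depending only on $m$, such that the following holds. Let $0<a<b<\infty$ and $\Omega=B_b\setminus\overline{B}_a(0)\subset\mathbb{R}^2$, and assume that $$\log\left(\frac{b}{a}\right)\geq R_{1,m}^{\ast}.$$ Then, for all $u\in W^{2,2}_0(\Omega)$, $$\int_{\Omega}\left(\Delta u+2(m-1)\frac{x}{|x|^2}\cdot\nabla u+\frac{(m-1)^2}{|x|^2}u\right)^2dx\geq\frac{\left(4m^2+\dfrac{\pi^2}{\log^2\left(\frac{b}{a}\right)}\right)\dfrac{\pi^2}{\log^2\left(\frac{b}{a}\right)}}{4(m^2+1)+\dfrac{2\pi^2}{\log^2\left(\frac{b}{a}\right)}}\int_{\Omega}\frac{|\nabla u|^2}{|x|^2}dx.$$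
   Context: $B_r=B_r(0)$ is the open ball of radius $r$ centred at $0$ in $\mathbb{R}^2$. $W^{2,2}_0(\Omega)$ is the closure of $C^\infty_c(\Omega)$ in $W^{2,2}(\Omega)$. *)

theory Defs
  imports "HOL-Analysis.Analysis"
begin

text \<open>
  Sobolev spaces \<open>W\<^sup>k\<^sup>,\<^sup>2\<close> of real-valued functions on an open subset \<open>S\<close> of a Euclidean space.
  Functions are total, but only their values on \<open>S\<close> matter, and those only up to null sets.
  A derivative of order \<open>k\<close> is indexed by a list of \<open>k\<close> standard basis vectors.
\<close>

primrec partials :: "'a::euclidean_space list \<Rightarrow> ('a \<Rightarrow> real) \<Rightarrow> 'a \<Rightarrow> real" where
  "partials [] f = f"
| "partials (i # is) f = (\<lambda>x. frechet_derivative (partials is f) (at x) i)"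

definition smooth :: "('a::euclidean_space \<Rightarrow> real) \<Rightarrow> bool" where
  "smooth f \<longleftrightarrow> (\<forall>is. set is \<subseteq> Basis \<longrightarrow> (\<forall>x. partials is f differentiable (at x)))"

text \<open>\<open>C\<^sub>c\<^sup>\<infinity>(S)\<close>; its elements are taken as functions on the whole space, extended by zero.\<close>

definition test_functions :: "'a::euclidean_space set \<Rightarrow> ('a \<Rightarrow> real) set" where
  "test_functions S =
    {\<phi>. smooth \<phi> \<and> compact (closure {x. \<phi> x \<noteq> 0}) \<and> closure {x. \<phi> x \<noteq> 0} \<subseteq> S}"

definition locally_integrable :: "'a::euclidean_space set \<Rightarrow> ('a \<Rightarrow> real) \<Rightarrow> bool" where
  "locally_integrable S f \<longleftrightarrow> (\<forall>K. compact K \<and> K \<subseteq> S \<longrightarrow> integrable (lebesgue_on K) f)"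

definition square_integrable :: "'a::euclidean_space set \<Rightarrow> ('a \<Rightarrow> real) \<Rightarrow> bool" where
  "square_integrable S f \<longleftrightarrow>
    f \<in> borel_measurable (lebesgue_on S) \<and> integrable (lebesgue_on S) (\<lambda>x. (f x)\<^sup>2)"

definition has_weak_deriv ::
    "'a::euclidean_space set \<Rightarrow> 'a list \<Rightarrow> ('a \<Rightarrow> real) \<Rightarrow> ('a \<Rightarrow> real) \<Rightarrow> bool" where
  "has_weak_deriv S is u v \<longleftrightarrow>
    locally_integrable S u \<and> locally_integrable S v \<and>
    (\<forall>\<phi>\<in>test_functions S.
      (LINT x|lebesgue_on S. u x * partials is \<phi> x) =
      (-1) ^ length is * (LINT x|lebesgue_on S. v x * \<phi> x))"

text \<open>
  Weak derivatives are unique only up to null sets; \<open>weak_deriv\<close> picks a representative.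
\<close>

definition weak_deriv ::
    "'a::euclidean_space set \<Rightarrow> 'a list \<Rightarrow> ('a \<Rightarrow> real) \<Rightarrow> 'a \<Rightarrow> real" where
  "weak_deriv S is u = (SOME v. has_weak_deriv S is u v)"

definition weak_gradient :: "'a::euclidean_space set \<Rightarrow> ('a \<Rightarrow> real) \<Rightarrow> 'a \<Rightarrow> 'a" where
  "weak_gradient S u x = (\<Sum>i\<in>Basis. weak_deriv S [i] u x *\<^sub>R i)"

definition weak_laplacian :: "'a::euclidean_space set \<Rightarrow> ('a \<Rightarrow> real) \<Rightarrow> 'a \<Rightarrow> real" where
  "weak_laplacian S u x = (\<Sum>i\<in>Basis. weak_deriv S [i, i] u x)"

definition sobolev :: "nat \<Rightarrow> 'a::euclidean_space set \<Rightarrow> ('a \<Rightarrow> real) set" where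
  "sobolev k S =
    {u. \<forall>is. set is \<subseteq> Basis \<and> length is \<le> k \<longrightarrow>
          (\<exists>v. has_weak_deriv S is u v \<and> square_integrable S v)}"

text \<open>
  The sum runs over lists rather than multi-indices, so each mixed derivative is counted once
  per ordering, as in \<open>\<parallel>u\<parallel>\<^sup>2 + \<parallel>\<nabla>u\<parallel>\<^sup>2 + \<parallel>\<nabla>\<^sup>2u\<parallel>\<^sup>2\<close> for \<open>k = 2\<close>.
\<close>

definition sobolev_norm :: "nat \<Rightarrow> 'a::euclidean_space set \<Rightarrow> ('a \<Rightarrow> real) \<Rightarrow> real" where
  "sobolev_norm k S u =
    sqrt (\<Sum>is | set is \<subseteq> Basis \<and> length is \<le> k. LINT x|lebesgue_on S. (weak_deriv S is u x)\<^sup>2)"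

text \<open>The closure of \<open>C\<^sub>c\<^sup>\<infinity>(S)\<close> in \<open>W\<^sup>k\<^sup>,\<^sup>2(S)\<close>.\<close>

definition sobolev0 :: "nat \<Rightarrow> 'a::euclidean_space set \<Rightarrow> ('a \<Rightarrow> real) set" where
  "sobolev0 k S =
    {u \<in> sobolev k S. \<forall>\<epsilon>>0. \<exists>\<phi>\<in>test_functions S. sobolev_norm k S (\<lambda>x. u x - \<phi> x) < \<epsilon>}"

definition annulus :: "real \<Rightarrow> real \<Rightarrow> (real^2) set" where
  "annulus a b = ball 0 b - cball 0 a"

end

theory Submission
  imports Defs
begin

text \<open>
  Let \<open>\<delta> = x \<cdot> \<nabla> - 1\<close> and let \<open>\<Theta>\<close> be the derivative along rotations. Then \<open>|x|\<^sup>2\<close> times the operator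
  in the theorem is \<open>(\<delta> + m)\<^sup>2 + \<Theta>\<^sup>2\<close>, and \<open>|x|\<^sup>2 |\<nabla>u|\<^sup>2 = (u + \<delta> u)\<^sup>2 + (\<Theta> u)\<^sup>2\<close>. So both integrals are
  quadratic expressions for the inner product \<open>\<langle>f, g\<rangle> = \<integral> f g / |x|\<^sup>4 dx\<close>, and the point is that \<open>\<delta>\<close> and \<open>\<Theta>\<close>
  are commuting skew-symmetric operators for it (\<open>radial_angular_skew\<close>, \<open>radial_angular_commute\<close>).
  Expanding the squares for a test function \<open>u\<close> on the annulus gives

    \<open>\<parallel>((\<delta> + m)\<^sup>2 + \<Theta>\<^sup>2) u\<parallel>\<^sup>2 = \<parallel>\<delta>\<^sup>2 u\<parallel>\<^sup>2 + 2 m\<^sup>2 \<parallel>\<delta> u\<parallel>\<^sup>2 + 2 \<parallel>\<delta> \<Theta> u\<parallel>\<^sup>2 + \<parallel>m\<^sup>2 u + \<Theta>\<^sup>2 u\<parallel>\<^sup>2\<close>,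

    \<open>\<integral> |\<nabla>u|\<^sup>2 / |x|\<^sup>2 dx = \<parallel>\<delta> u\<parallel>\<^sup>2 + \<parallel>u\<parallel>\<^sup>2 + \<parallel>\<Theta> u\<parallel>\<^sup>2\<close>

  (\<open>weighted_norm_identity\<close>, \<open>weighted_gradient_identity\<close>). In the variable \<open>ln |x|\<close> the annulus has
  width \<open>ln (b / a)\<close>, and the Poincare inequality \<open>weighted_poincare\<close> reads
  \<open>\<parallel>\<delta> f\<parallel>\<^sup>2 \<ge> \<lambda> \<parallel>f\<parallel>\<^sup>2\<close> with \<open>\<lambda> = \<pi>\<^sup>2 / ln\<^sup>2 (b / a)\<close>. Used for \<open>f = \<delta> u\<close>, \<open>f = u\<close> and \<open>f = \<Theta> u\<close>, and with
  \<open>m \<ge> 1\<close>, it bounds the first expression below by \<open>\<lambda>\<close> times the second. The constant in the theorem is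
  \<open>\<lambda> (4 m\<^sup>2 + \<lambda>) / (4 (m\<^sup>2 + 1) + 2 \<lambda>) \<le> \<lambda>\<close>.

  The remaining work is the passage from test functions to the Sobolev space. The weak derivatives in
  the theorem are chosen representatives, so they have to be identified almost everywhere; this is
  the fundamental lemma of the calculus of variations \<open>AE_eq_0_if_test_integrals_eq_0\<close>, for which
  enough smooth bump functions are constructed. On the annulus \<open>1 / |x|\<close> is bounded, so
  both sides of the inequality are continuous under the approximation by test functions
  (\<open>sobolev0_approximation\<close>, \<open>tends_in_L2_integral\<close>).
\<close>

section \<open>Partial derivatives and smooth functions\<close>

definition pd :: "'a::euclidean_space \<Rightarrow> ('a \<Rightarrow> real) \<Rightarrow> 'a \<Rightarrow> real" where
  "pd i f x = frechet_derivative f (at x) i"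

lemma partials_Cons: "partials (i # is) f = pd i (partials is f)"
  by (simp add: pd_def fun_eq_iff)

lemma partials_append: "partials (is @ js) f = partials is (partials js f)"
  by (induction "is") auto

lemma partials_snoc: "partials (is @ [i]) f = partials is (pd i f)"
  unfolding partials_append by (simp add: pd_def[abs_def])

lemma has_derivative_imp_pd:
  "(f has_derivative f') (at x) \<Longrightarrow> pd i f x = f' i"
  unfolding pd_def using frechet_derivative_at by metis

lemma differentiable_imp_has_derivative_pd:
  "f differentiable (at x) \<Longrightarrow> (f has_derivative (\<lambda>i. pd i f x)) (at x)"
  unfolding pd_def by (simp add: frechet_derivative_works[symmetric])

lemma smooth_differentiable: "smooth f \<Longrightarrow> f differentiable (at x)"
  unfolding smooth_def by (metis empty_set empty_subsetI partials.simps(1))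

lemma smooth_has_derivative: "smooth f \<Longrightarrow> (f has_derivative (\<lambda>i. pd i f x)) (at x)"
  by (simp add: differentiable_imp_has_derivative_pd smooth_differentiable)

lemma smooth_pd: "smooth f \<Longrightarrow> i \<in> Basis \<Longrightarrow> smooth (pd i f)"
  unfolding smooth_def
proof (intro allI impI)
  fix "is" :: "'a list" and x :: 'a
  assume "\<forall>is. set is \<subseteq> Basis \<longrightarrow> (\<forall>x. partials is f differentiable at x)" "i \<in> Basis" "set is \<subseteq> Basis"
  then have "partials (is @ [i]) f differentiable at x" by simp
  then show "partials is (pd i f) differentiable at x" by (simp only: partials_snoc)
qed

lemma smooth_partials: "smooth f \<Longrightarrow> set is \<subseteq> Basis \<Longrightarrow> smooth (partials is f)"
  by (induction "is") (simp_all add: partials_Cons smooth_pd del: partials.simps(2))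

lemma smooth_continuous_on: "smooth f \<Longrightarrow> continuous_on S f"
  by (meson continuous_at_imp_continuous_on differentiable_imp_continuous_within smooth_differentiable)

text \<open>
  Smoothness of an explicit function is proved by exhibiting an algebra of differentiable functions
  that contains it and is closed under partial derivatives; it is enough to check the closure on
  generators, because the sum and the product rule take care of the rest.
\<close>

inductive_set algebra_hull :: "('a::euclidean_space \<Rightarrow> real) set \<Rightarrow> ('a \<Rightarrow> real) set" for G where
  base: "g \<in> G \<Longrightarrow> g \<in> algebra_hull G"
| const: "(\<lambda>x. c) \<in> algebra_hull G"
| add: "f \<in> algebra_hull G \<Longrightarrow> g \<in> algebra_hull G \<Longrightarrow> (\<lambda>x. f x + g x) \<in> algebra_hull G"
| mult: "f \<in> algebra_hull G \<Longrightarrow> g \<in> algebra_hull G \<Longrightarrow> (\<lambda>x. f x * g x) \<in> algebra_hull G"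

lemma algebra_hull_smooth:
  assumes diff: "\<And>g x. g \<in> G \<Longrightarrow> g differentiable (at x)"
    and pd: "\<And>g i. g \<in> G \<Longrightarrow> i \<in> Basis \<Longrightarrow> pd i g \<in> algebra_hull G"
    and f: "f \<in> algebra_hull G"
  shows "smooth f"
proof -
  have step: "(\<forall>x. f differentiable (at x)) \<and> (\<forall>i\<in>Basis. pd i f \<in> algebra_hull G)"
    if "f \<in> algebra_hull G" for f
    using that
  proof induction
    case (base g)
    then show ?case using diff pd by blast
  next
    case (const c)
    have "pd i (\<lambda>x. c) = (\<lambda>x. 0)" for i :: 'a
      by (rule ext) (rule has_derivative_imp_pd, auto intro!: derivative_eq_intros)
    then show ?case by (auto intro: algebra_hull.const)
  next
    case (add f g)
    have "((\<lambda>x. f x + g x) has_derivative (\<lambda>i. pd i f x + pd i g x)) (at x)" for x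
      using add by (auto intro!: derivative_intros differentiable_imp_has_derivative_pd)
    then have "pd i (\<lambda>x. f x + g x) = (\<lambda>x. pd i f x + pd i g x)" for i
      using has_derivative_imp_pd by blast
    then show ?case using add by (auto intro!: algebra_hull.add)
  next
    case (mult f g)
    have "((\<lambda>x. f x * g x) has_derivative (\<lambda>i. f x * pd i g x + pd i f x * g x)) (at x)" for x
      using mult by (auto intro!: derivative_eq_intros differentiable_imp_has_derivative_pd)
    then have "pd i (\<lambda>x. f x * g x) = (\<lambda>x. f x * pd i g x + pd i f x * g x)" for i
      using has_derivative_imp_pd by blast
    then show ?case using mult by (auto intro!: algebra_hull.add algebra_hull.mult)
  qed
  have "partials is f \<in> algebra_hull G" if "set is \<subseteq> Basis" for "is"
    using that by (induction "is") (use f step in \<open>auto simp: partials_Cons simp del: partials.simps(2)\<close>)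
  with step show ?thesis unfolding smooth_def by blast
qed

text \<open>
  The same closure principle, applied to the smooth functions themselves as generators, shows that
  they form an algebra.
\<close>

lemma algebra_hull_of_smooth: "f \<in> algebra_hull {g. smooth g} \<Longrightarrow> smooth f"
  by (rule algebra_hull_smooth) (auto intro: smooth_differentiable smooth_pd algebra_hull.base)

lemma smooth_const: "smooth (\<lambda>x. c)"
  by (rule algebra_hull_of_smooth) (rule algebra_hull.const)

lemma smooth_add: "smooth f \<Longrightarrow> smooth g \<Longrightarrow> smooth (\<lambda>x. f x + g x)"
  by (rule algebra_hull_of_smooth) (rule algebra_hull.add; simp add: algebra_hull.base)

lemma smooth_mult: "smooth f \<Longrightarrow> smooth g \<Longrightarrow> smooth (\<lambda>x. f x * g x)"
  by (rule algebra_hull_of_smooth) (rule algebra_hull.mult; simp add: algebra_hull.base)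

lemma smooth_inner: "smooth (\<lambda>x. x \<bullet> v)"
proof (rule algebra_hull_smooth)
  have *: "((\<lambda>x. x \<bullet> v) has_derivative (\<lambda>i. i \<bullet> v)) (at x)" for x
    by (auto intro!: derivative_eq_intros)
  show "(\<lambda>x. x \<bullet> v) \<in> algebra_hull {\<lambda>x. x \<bullet> v}" by (auto intro: algebra_hull.base)
  show "g differentiable (at x)" if "g \<in> {\<lambda>x. x \<bullet> v}" for g x
    using that * differentiable_def by blast
  show "pd i g \<in> algebra_hull {\<lambda>x. x \<bullet> v}" if "g \<in> {\<lambda>x. x \<bullet> v}" for g i
  proof -
    have "pd i g = (\<lambda>x. i \<bullet> v)" using that has_derivative_imp_pd[OF *] by auto
    then show ?thesis by (simp add: algebra_hull.const)
  qed
qed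

lemma pd_const: "pd i (\<lambda>x. c) = (\<lambda>x. 0)"
  by (rule ext, rule has_derivative_imp_pd) (auto intro!: derivative_eq_intros)

lemma pd_add: "smooth f \<Longrightarrow> smooth g \<Longrightarrow> pd i (\<lambda>x. f x + g x) = (\<lambda>x. pd i f x + pd i g x)"
  by (rule ext, rule has_derivative_imp_pd) (auto intro!: derivative_eq_intros smooth_has_derivative)

lemma pd_mult:
  "smooth f \<Longrightarrow> smooth g \<Longrightarrow> pd i (\<lambda>x. f x * g x) = (\<lambda>x. f x * pd i g x + pd i f x * g x)"
  by (rule ext, rule has_derivative_imp_pd) (auto intro!: derivative_eq_intros smooth_has_derivative)

lemma pd_inner: "pd i (\<lambda>x. x \<bullet> v) = (\<lambda>x. i \<bullet> v)"
  by (rule ext, rule has_derivative_imp_pd) (auto intro!: derivative_eq_intros)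

section \<open>Symmetry of second derivatives\<close>

lemma has_derivative_line:
  fixes F :: "'a::real_normed_vector \<Rightarrow> real"
  assumes "(F has_derivative F') (at (x + s *\<^sub>R i))"
  shows "((\<lambda>s. F (x + s *\<^sub>R i)) has_real_derivative F' i) (at s)"
proof -
  have "((\<lambda>s. F (x + s *\<^sub>R i)) has_derivative (\<lambda>h. F' (h *\<^sub>R i))) (at s)"
    by (rule has_derivative_compose[where g=F and f="\<lambda>s. x + s *\<^sub>R i", OF _ assms]) (auto intro!: derivative_eq_intros)
  then show ?thesis
    using linear_scale[OF has_derivative_linear[OF assms]] unfolding has_field_derivative_def
    by (simp add: mult_commute_abs)
qed

lemma smooth_line_derivative:
  assumes "smooth f"
  shows "((\<lambda>s. f (x + s *\<^sub>R i)) has_real_derivative pd i f (x + s *\<^sub>R i)) (at s)"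
  by (rule has_derivative_line[OF smooth_has_derivative[OF assms]])

text \<open>
  The second difference over a square of side \<open>h\<close> is symmetric in \<open>i\<close> and \<open>j\<close>; two applications of
  the mean value theorem turn it into \<open>h\<^sup>2\<close> times a mixed derivative at a point of the square.
\<close>

lemma smooth_mixed_difference:
  assumes f: "smooth f" and i: "i \<in> Basis" and j: "j \<in> Basis" and h: "h > 0"
  shows "\<exists>s t. 0 < s \<and> s < h \<and> 0 < t \<and> t < h \<and>
    f (x + h *\<^sub>R i + h *\<^sub>R j) - f (x + h *\<^sub>R i) - f (x + h *\<^sub>R j) + f x
      = h\<^sup>2 * pd j (pd i f) (x + s *\<^sub>R i + t *\<^sub>R j)"
proof -
  define g where "g s = f ((x + h *\<^sub>R j) + s *\<^sub>R i) - f (x + s *\<^sub>R i)" for s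
  have g': "(g has_real_derivative (pd i f ((x + h *\<^sub>R j) + s *\<^sub>R i) - pd i f (x + s *\<^sub>R i))) (at s)" for s
    unfolding g_def by (intro DERIV_diff smooth_line_derivative f)
  obtain s where s: "0 < s" "s < h"
    "g h - g 0 = (h - 0) * (pd i f ((x + h *\<^sub>R j) + s *\<^sub>R i) - pd i f (x + s *\<^sub>R i))"
    using MVT2[OF h g'] by blast
  define k where "k t = pd i f ((x + s *\<^sub>R i) + t *\<^sub>R j)" for t
  have k': "(k has_real_derivative pd j (pd i f) ((x + s *\<^sub>R i) + t *\<^sub>R j)) (at t)" for t
    unfolding k_def by (intro smooth_line_derivative smooth_pd f i)
  obtain t where t: "0 < t" "t < h" "k h - k 0 = (h - 0) * pd j (pd i f) ((x + s *\<^sub>R i) + t *\<^sub>R j)"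
    using MVT2[OF h k'] by blast
  have "g h - g 0 = h * (k h - k 0)"
    using s(3) by (simp add: k_def algebra_simps)
  also have "\<dots> = h\<^sup>2 * pd j (pd i f) (x + s *\<^sub>R i + t *\<^sub>R j)"
    using t(3) by (simp add: power2_eq_square)
  finally show ?thesis
    using s t unfolding g_def by (intro exI[of _ s] exI[of _ t]) (simp add: algebra_simps)
qed

text \<open>
  Computed in both orders, the second difference gives equal values of the two mixed derivatives at two
  points near \<open>x\<close>; continuity lets the points tend to \<open>x\<close>.
\<close>

lemma pd_commute:
  assumes f: "smooth f" and i: "i \<in> Basis" and j: "j \<in> Basis"
  shows "pd i (pd j f) = pd j (pd i f)"
proof (rule ext, rule ccontr)
  fix x
  assume ne: "pd i (pd j f) x \<noteq> pd j (pd i f) x"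
  define e where "e = dist (pd i (pd j f) x) (pd j (pd i f) x) / 2"
  have e: "e > 0" using ne by (simp add: e_def)
  have "isCont (pd i (pd j f)) x" "isCont (pd j (pd i f)) x"
    using f i j by (auto intro!: smooth_pd differentiable_imp_continuous_within smooth_differentiable)
  then obtain d1 d2 where d: "d1 > 0" "d2 > 0"
    "\<And>y. dist y x < d1 \<Longrightarrow> dist (pd i (pd j f) y) (pd i (pd j f) x) < e"
    "\<And>y. dist y x < d2 \<Longrightarrow> dist (pd j (pd i f) y) (pd j (pd i f) x) < e"
    using e unfolding continuous_at_eps_delta by metis
  define h where "h = min d1 d2 / 2"
  have h: "h > 0" using d by (simp add: h_def)
  obtain s t where st: "0 < s" "s < h" "0 < t" "t < h"
    "f (x + h *\<^sub>R i + h *\<^sub>R j) - f (x + h *\<^sub>R i) - f (x + h *\<^sub>R j) + f x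
      = h\<^sup>2 * pd j (pd i f) (x + s *\<^sub>R i + t *\<^sub>R j)"
    using smooth_mixed_difference[OF f i j h] by blast
  obtain s' t' where st': "0 < s'" "s' < h" "0 < t'" "t' < h"
    "f (x + h *\<^sub>R j + h *\<^sub>R i) - f (x + h *\<^sub>R j) - f (x + h *\<^sub>R i) + f x
      = h\<^sup>2 * pd i (pd j f) (x + s' *\<^sub>R j + t' *\<^sub>R i)"
    using smooth_mixed_difference[OF f j i h] by blast
  have "h\<^sup>2 * pd i (pd j f) (x + s' *\<^sub>R j + t' *\<^sub>R i) = h\<^sup>2 * pd j (pd i f) (x + s *\<^sub>R i + t *\<^sub>R j)"
    using st(5) st'(5) by (simp only: add.commute[of "h *\<^sub>R i"] add.assoc)
  then have eq: "pd i (pd j f) (x + s' *\<^sub>R j + t' *\<^sub>R i) = pd j (pd i f) (x + s *\<^sub>R i + t *\<^sub>R j)"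
    using h by simp
  have near: "dist (x + \<sigma> *\<^sub>R k + \<tau> *\<^sub>R l) x < min d1 d2"
    if "0 < \<sigma>" "\<sigma> < h" "0 < \<tau>" "\<tau> < h" "k \<in> Basis" "l \<in> Basis" for \<sigma> \<tau> k l
  proof -
    have "dist (x + \<sigma> *\<^sub>R k + \<tau> *\<^sub>R l) x = norm (\<sigma> *\<^sub>R k + \<tau> *\<^sub>R l)"
      by (simp add: dist_norm)
    also have "\<dots> \<le> \<sigma> + \<tau>"
      using norm_triangle_ineq[of "\<sigma> *\<^sub>R k" "\<tau> *\<^sub>R l"] that by simp
    also have "\<dots> < min d1 d2" using that by (simp add: h_def)
    finally show ?thesis .
  qed
  have far1: "dist (pd i (pd j f) (x + s' *\<^sub>R j + t' *\<^sub>R i)) (pd i (pd j f) x) < e"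
    using near[OF st'(1-4) j i] by (intro d(3)) simp
  have far2: "dist (pd j (pd i f) (x + s *\<^sub>R i + t *\<^sub>R j)) (pd j (pd i f) x) < e"
    using near[OF st(1-4) i j] by (intro d(4)) simp
  show False
    using dist_triangle_half_r[OF far1[unfolded eq e_def] far2[unfolded e_def]] by simp
qed

lemma pd_partials_commute:
  assumes "smooth f" "i \<in> Basis" "set is \<subseteq> Basis"
  shows "pd i (partials is f) = partials is (pd i f)"
  using assms(3)
proof (induction "is")
  case (Cons j "is")
  then have "pd i (partials (j # is) f) = pd j (pd i (partials is f))"
    using assms unfolding partials_Cons by (intro pd_commute smooth_partials) auto
  with Cons show ?case by (simp add: partials_Cons del: partials.simps(2))
qed simp

section \<open>Bump functions\<close>

text \<open>
  The standard flat function \<open>exp (- 1 / t)\<close>, divided by powers of \<open>t\<close> so that the family is closed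
  under differentiation up to linear combinations.
\<close>

definition flat :: "nat \<Rightarrow> real \<Rightarrow> real" where
  "flat k t = (if t > 0 then exp (- 1 / t) / t ^ k else 0)"

text \<open>
  Quadratic decay at \<open>0\<close> is what makes the derivative at the origin vanish. It comes from
  \<open>(1 + s / n)\<^sup>n \<le> exp s\<close> with \<open>s = 1 / t\<close> and \<open>n = k + 2\<close>.
\<close>

lemma flat_bound: "\<bar>flat k t\<bar> \<le> real (k + 2) ^ (k + 2) * t\<^sup>2"
proof (cases "t > 0")
  case True
  define n where "n = k + 2"
  define y where "y = t * real n"
  have n: "n > 0" by (simp add: n_def)
  have y: "y > 0" using True n by (simp add: y_def)
  have "(1 / y) ^ n \<le> (1 + 1 / t / real n) ^ n"
    using True n by (intro power_mono) (auto simp: y_def)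
  also have "\<dots> \<le> exp (1 / t)"
  proof (rule exp_ge_one_plus_x_over_n_power_n)
    have "0 \<le> 1 / t" using True by simp
    then show "- real n \<le> 1 / t" by linarith
  qed (use n in simp)
  finally have "1 \<le> exp (1 / t) * y ^ n"
    using y by (simp add: power_divide pos_divide_le_eq)
  then have "exp (- 1 / t) * 1 \<le> exp (- 1 / t) * (exp (1 / t) * y ^ n)"
    by (intro mult_left_mono) auto
  also have "\<dots> = y ^ n"
    by (simp add: exp_minus)
  also have "y ^ n = (real n ^ n * t\<^sup>2) * t ^ k"
    unfolding y_def power_mult_distrib by (simp only: n_def power_add mult_ac)
  finally show ?thesis using True unfolding n_def by (simp add: flat_def pos_divide_le_eq)
qed (simp add: flat_def)

lemma flat_DERIV:
  "(flat k has_real_derivative flat (k + 2) t - k * flat (k + 1) t) (at t)"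
proof -
  consider "t > 0" | "t < 0" | "t = 0" by linarith
  then show ?thesis
  proof cases
    case 1
    have "((\<lambda>t. exp (- 1 / t) / t ^ k) has_real_derivative
        (exp (- 1 / t) * (1 / t\<^sup>2) * t ^ k - exp (- 1 / t) * (k * t ^ (k - 1))) / (t ^ k * t ^ k)) (at t)"
      using 1 by (auto intro!: derivative_eq_intros simp: power2_eq_square)
    also have "(exp (- 1 / t) * (1 / t\<^sup>2) * t ^ k - exp (- 1 / t) * (k * t ^ (k - 1))) / (t ^ k * t ^ k)
        = flat (k + 2) t - k * flat (k + 1) t"
    proof (cases k)
      case (Suc l)
      then show ?thesis using 1 by (simp add: flat_def divide_simps power2_eq_square) (simp add: algebra_simps)
    qed (use 1 in \<open>simp add: flat_def power2_eq_square\<close>)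
    finally show ?thesis
      by (rule has_field_derivative_transform_within_open[where S="{0<..}"]) (use 1 in \<open>auto simp: flat_def\<close>)
  next
    case 2
    have "((\<lambda>t. 0) has_real_derivative flat (k + 2) t - k * flat (k + 1) t) (at t)"
      using 2 by (simp add: flat_def)
    then show ?thesis
      by (rule has_field_derivative_transform_within_open[where S="{..<0}"]) (use 2 in \<open>auto simp: flat_def\<close>)
  next
    case 3
    define M where "M = real (k + 2) ^ (k + 2)"
    have "((\<lambda>h. M * \<bar>h\<bar>) \<longlongrightarrow> 0) (at (0::real))"
      by (auto intro!: tendsto_eq_intros)
    moreover have "norm (flat k h / h) \<le> M * \<bar>h\<bar>" if "h \<noteq> 0" for h
    proof -
      have "\<bar>flat k h\<bar> \<le> M * \<bar>h\<bar> * \<bar>h\<bar>"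
        using flat_bound[of k h] by (simp add: M_def power2_eq_square mult.assoc)
      then show ?thesis using that by (simp add: pos_divide_le_eq)
    qed
    then have "\<forall>\<^sub>F h in at 0. norm (flat k h / h) \<le> M * \<bar>h\<bar>"
      by (rule eventually_mono[OF eventually_neq_at_within])
    ultimately have "((\<lambda>h. flat k h / h) \<longlongrightarrow> 0) (at 0)"
      by (rule Lim_null_comparison[rotated])
    then show ?thesis using 3 by (simp add: has_field_derivative_iff flat_def)
  qed
qed

definition flat_affine :: "('a::euclidean_space \<Rightarrow> real) set" where
  "flat_affine = {\<lambda>x. flat k (x \<bullet> v + c) | k v c. True}"

lemma flat_affine_in_hull: "(\<lambda>x. flat k (x \<bullet> v + c)) \<in> algebra_hull flat_affine"
  by (rule algebra_hull.base) (unfold flat_affine_def, blast)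

lemma algebra_hull_flat_affine_smooth:
  assumes "f \<in> algebra_hull flat_affine"
  shows "smooth f"
proof (rule algebra_hull_smooth[OF _ _ assms])
  fix g :: "'a \<Rightarrow> real" assume "g \<in> flat_affine"
  then obtain k v c where g: "g = (\<lambda>x. flat k (x \<bullet> v + c))" unfolding flat_affine_def by blast
  have g': "(g has_derivative (\<lambda>i. (i \<bullet> v) * (flat (k + 2) (x \<bullet> v + c) - k * flat (k + 1) (x \<bullet> v + c)))) (at x)" for x
  proof -
    have "((\<lambda>x. x \<bullet> v + c) has_derivative (\<lambda>i. i \<bullet> v)) (at x)"
      by (auto intro!: derivative_eq_intros)
    from DERIV_compose_FDERIV[OF flat_DERIV this] show ?thesis by (simp only: g)
  qed
  show "g differentiable (at x)" for x using g' differentiable_def by blast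
  fix i :: 'a
  have *: "(\<lambda>x. flat l (x \<bullet> v + c)) \<in> algebra_hull flat_affine" for l
    by (rule flat_affine_in_hull)
  have "pd i g = (\<lambda>x. (i \<bullet> v) * (flat (k + 2) (x \<bullet> v + c) + (- real k) * flat (k + 1) (x \<bullet> v + c)))"
    using has_derivative_imp_pd[OF g'] by (simp add: fun_eq_iff)
  then show "pd i g \<in> algebra_hull flat_affine"
    by (simp only: algebra_hull.add algebra_hull.mult algebra_hull.const *)
qed

text \<open>
  For \<open>n > 0\<close> the function is positive exactly on the open box. Since \<open>flat 0 (n t) = exp (- 1 / (n t))\<close>
  tends to \<open>1\<close> for \<open>t > 0\<close>, the functions approach the indicator function of the box as \<open>n\<close> grows.
\<close>

definition box_bump :: "'a::euclidean_space \<Rightarrow> 'a \<Rightarrow> nat \<Rightarrow> 'a \<Rightarrow> real" where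
  "box_bump c d n x = (\<Prod>i\<in>Basis. flat 0 (real n * ((x - c) \<bullet> i)) * flat 0 (real n * ((d - x) \<bullet> i)))"

lemma smooth_box_bump: "smooth (box_bump c d n)"
proof (rule algebra_hull_flat_affine_smooth)
  have *: "(\<lambda>x. flat 0 (real n * ((x - c) \<bullet> i))) \<in> algebra_hull flat_affine"
    "(\<lambda>x. flat 0 (real n * ((d - x) \<bullet> i))) \<in> algebra_hull flat_affine" for i
  proof -
    have eqs: "(\<lambda>x. flat 0 (real n * ((x - c) \<bullet> i))) = (\<lambda>x. flat 0 (x \<bullet> (real n *\<^sub>R i) + (- real n * (c \<bullet> i))))"
      "(\<lambda>x. flat 0 (real n * ((d - x) \<bullet> i))) = (\<lambda>x. flat 0 (x \<bullet> (- real n *\<^sub>R i) + (real n * (d \<bullet> i))))"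
      by (simp_all add: algebra_simps)
    show "(\<lambda>x. flat 0 (real n * ((x - c) \<bullet> i))) \<in> algebra_hull flat_affine"
      "(\<lambda>x. flat 0 (real n * ((d - x) \<bullet> i))) \<in> algebra_hull flat_affine"
      by (simp_all only: eqs flat_affine_in_hull)
  qed
  have "(\<lambda>x. \<Prod>i\<in>B. flat 0 (real n * ((x - c) \<bullet> i)) * flat 0 (real n * ((d - x) \<bullet> i)))
      \<in> algebra_hull flat_affine" if "finite B" for B
    using that by induction (simp_all add: algebra_hull.const algebra_hull.mult *)
  then show "box_bump c d n \<in> algebra_hull flat_affine"
    unfolding box_bump_def[abs_def] by simp
qed

lemma box_bump_zero: "x \<notin> box c d \<Longrightarrow> box_bump c d n x = 0"
  by (fastforce simp: box_bump_def mem_box flat_def inner_diff_left zero_less_mult_iff)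

lemma flat0_bounds: "0 \<le> flat 0 t" "flat 0 t \<le> 1"
  by (auto simp: flat_def)

lemma box_bump_bounds: "0 \<le> box_bump c d n x" "box_bump c d n x \<le> 1"
  unfolding box_bump_def using flat0_bounds
  by (auto intro!: prod_nonneg prod_le_1 mult_le_one)

lemma box_bump_limit: "(\<lambda>n. box_bump c d n x) \<longlonglongrightarrow> indicator (box c d) x"
proof (cases "x \<in> box c d")
  case True
  have *: "(\<lambda>n. flat 0 (real n * t)) \<longlonglongrightarrow> 1" if "t > 0" for t
  proof -
    have "(\<lambda>n. exp (- (1 / t) * (1 / real n))) \<longlonglongrightarrow> exp (- (1 / t) * 0)"
      by (intro tendsto_intros lim_1_over_n)
    moreover have "\<forall>\<^sub>F n in sequentially. exp (- (1 / t) * (1 / real n)) = flat 0 (real n * t)"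
      using eventually_gt_at_top[of 0] by eventually_elim (use that in \<open>simp add: flat_def field_simps\<close>)
    ultimately show ?thesis using Lim_transform_eventually by fastforce
  qed
  have "(\<lambda>n. box_bump c d n x) \<longlonglongrightarrow> (\<Prod>i\<in>(Basis::'a set). 1 * 1)"
    unfolding box_bump_def using True
    by (intro tendsto_prod tendsto_mult *) (auto simp: mem_box inner_diff_left)
  then show ?thesis using True by simp
qed (simp add: box_bump_zero)

lemma box_bump_test:
  assumes "cbox c d \<subseteq> S"
  shows "box_bump c d n \<in> test_functions S"
proof -
  have "closure {x. box_bump c d n x \<noteq> 0} \<subseteq> cbox c d"
    by (rule closure_minimal) (use box_bump_zero box_subset_cbox in blast, rule closed_cbox)
  moreover from this have "compact (closure {x. box_bump c d n x \<noteq> 0})"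
    by (metis bounded_cbox bounded_subset closed_closure compact_eq_bounded_closed)
  ultimately show ?thesis using assms smooth_box_bump unfolding test_functions_def by auto
qed

section \<open>Integrals of compactly supported functions\<close>

lemma integral_lebesgue_on_subset:
  fixes f :: "'a::euclidean_space \<Rightarrow> real"
  assumes "S \<in> sets lebesgue" "T \<in> sets lebesgue" "T \<subseteq> S" "\<And>x. x \<in> S - T \<Longrightarrow> f x = 0"
  shows "(LINT x|lebesgue_on S. f x) = (LINT x|lebesgue_on T. f x)"
    and "integrable (lebesgue_on S) f \<longleftrightarrow> integrable (lebesgue_on T) f"
proof -
  have eq: "(\<lambda>x. indicator S x *\<^sub>R f x) = (\<lambda>x. indicator T x *\<^sub>R f x)"
    using assms(3,4) by (auto simp: fun_eq_iff indicator_def)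
  show "(LINT x|lebesgue_on S. f x) = (LINT x|lebesgue_on T. f x)"
    "integrable (lebesgue_on S) f \<longleftrightarrow> integrable (lebesgue_on T) f"
    using assms(1,2) eq by (simp_all add: integral_restrict_space integrable_restrict_space)
qed

lemma integrable_lebesgue_on_compact:
  fixes f :: "'a::euclidean_space \<Rightarrow> real"
  assumes "compact K" "continuous_on K f"
  shows "integrable (lebesgue_on K) f"
proof -
  have K: "K \<in> sets borel" using assms(1) by (simp add: borel_compact)
  have "integrable lborel (\<lambda>x. indicator K x *\<^sub>R f x)"
    using assms by (rule borel_integrable_compact)
  then have "integrable lebesgue (\<lambda>x. indicator K x *\<^sub>R f x)"
    by (subst integrable_completion) auto
  then show ?thesis
    using K by (subst integrable_restrict_space) (auto intro: sets_completionI_sets)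
qed

lemma locally_integrable_continuous: "continuous_on S f \<Longrightarrow> locally_integrable S f"
  unfolding locally_integrable_def
  using integrable_lebesgue_on_compact continuous_on_subset by blast

lemma integrable_compactly_supported_mult:
  assumes S: "open S" and u: "locally_integrable S u"
    and \<psi>: "continuous_on S \<psi>" and K: "compact K" "K \<subseteq> S" "\<And>x. x \<notin> K \<Longrightarrow> \<psi> x = 0"
  shows "integrable (lebesgue_on S) (\<lambda>x. u x * \<psi> x)"
proof -
  have uK: "integrable (lebesgue_on K) u"
    using u K unfolding locally_integrable_def by blast
  have cK: "continuous_on K \<psi>" using \<psi> K(2) continuous_on_subset by blast
  have "bounded (\<psi> ` K)"
    using cK K(1) compact_continuous_image compact_imp_bounded by blast
  then obtain M where M: "\<And>x. x \<in> K \<Longrightarrow> norm (\<psi> x) \<le> M"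
    unfolding bounded_iff by blast
  have Ks: "K \<in> sets lebesgue" using K(1) by (simp add: borel_compact sets_completionI_sets)
  have "integrable (lebesgue_on K) (\<lambda>x. u x * \<psi> x)"
  proof (rule Bochner_Integration.integrable_bound)
    show "integrable (lebesgue_on K) (\<lambda>x. u x * M)" using uK by simp
    show "(\<lambda>x. u x * \<psi> x) \<in> borel_measurable (lebesgue_on K)"
      using uK continuous_imp_measurable_on_sets_lebesgue[OF cK Ks] by auto
    have "norm (u x * \<psi> x) \<le> norm (u x * M)" if "x \<in> K" for x
      using M[OF that] by (auto simp: abs_mult intro!: mult_left_mono)
    then show "AE x in lebesgue_on K. norm (u x * \<psi> x) \<le> norm (u x * M)"
      by (intro AE_I2) simp
  qed
  then show ?thesis
    using integral_lebesgue_on_subset(2)[of S K "\<lambda>x. u x * \<psi> x"] S Ks K by auto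
qed

lemma has_derivative_zero_off_closed:
  fixes f :: "'a::real_normed_vector \<Rightarrow> real"
  assumes "closed K" "\<And>x. x \<notin> K \<Longrightarrow> f x = 0" "x \<notin> K"
  shows "(f has_derivative (\<lambda>h. 0)) (at x)"
  by (rule has_derivative_transform_within_open[of "\<lambda>x. 0" _ x UNIV "- K"])
    (use assms in \<open>auto simp: open_Compl\<close>)

lemma integral_lborel_translation:
  fixes f :: "'a::euclidean_space \<Rightarrow> real"
  assumes "f \<in> borel_measurable borel"
  shows "(\<integral>x. f (x + c) \<partial>lborel) = (\<integral>x. f x \<partial>lborel)"
    and "integrable lborel f \<Longrightarrow> integrable lborel (\<lambda>x. f (x + c))"
proof -
  have "(\<integral>x. f x \<partial>lborel) = (\<integral>x. f x \<partial>distr lborel borel ((+) c))"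
    by (simp add: lborel_distr_plus)
  also have "\<dots> = (\<integral>x. f (c + x) \<partial>lborel)"
    using assms by (intro integral_distr) auto
  finally show "(\<integral>x. f (x + c) \<partial>lborel) = (\<integral>x. f x \<partial>lborel)"
    by (simp add: add.commute)
  assume "integrable lborel f"
  then have "integrable (distr lborel borel ((+) c)) f" by (simp add: lborel_distr_plus)
  then have "integrable lborel (\<lambda>x. f (c + x))"
    using assms by (subst (asm) integrable_distr_eq) auto
  then show "integrable lborel (\<lambda>x. f (x + c))" by (simp add: add.commute)
qed

text \<open>
  The integral of a difference quotient vanishes by translation invariance. The difference quotients
  converge pointwise to the directional derivative and are dominated, by the mean value theorem, by a
  constant on a ball that contains all their supports.
\<close>

lemma integral_directional_derivative_lborel:
  fixes F :: "'a::euclidean_space \<Rightarrow> real"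
  assumes F: "\<And>x. (F has_derivative F' x) (at x)"
    and cont: "continuous_on UNIV (\<lambda>x. F' x i)"
    and K: "compact K" "\<And>x. x \<notin> K \<Longrightarrow> F x = 0"
  shows "integrable lborel (\<lambda>x. F' x i)" "(\<integral>x. F' x i \<partial>lborel) = 0"
proof -
  have F'0: "F' x i = 0" if "x \<notin> K" for x
    using has_derivative_unique[OF F has_derivative_zero_off_closed[of K F x]] K that
    by (simp add: compact_imp_closed)
  have "bounded ((\<lambda>x. F' x i) ` K)"
    using K(1) compact_continuous_image compact_imp_bounded continuous_on_subset[OF cont] by blast
  then obtain M0 where M0: "\<And>x. x \<in> K \<Longrightarrow> norm (F' x i) \<le> M0"
    unfolding bounded_iff by blast
  define M where "M = max M0 0"
  have M: "\<bar>F' x i\<bar> \<le> M" for x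
    using M0[of x] F'0[of x] by (cases "x \<in> K") (auto simp: M_def)
  obtain r where r: "\<And>x. x \<in> K \<Longrightarrow> norm x \<le> r"
    using compact_imp_bounded[OF K(1)] unfolding bounded_iff by blast
  define w where "w x = indicator (cball 0 (r + norm i)) x * M" for x :: 'a
  define h where "h n = inverse (real (Suc n))" for n
  have h: "0 < h n" "h n \<le> 1" for n by (auto simp: h_def inverse_le_1_iff)
  define s where "s n x = (F (x + h n *\<^sub>R i) - F x) / h n" for n x
  have contF: "continuous_on UNIV F"
    using has_derivative_continuous[OF F] by (simp add: continuous_at_imp_continuous_on)
  have Fm: "F \<in> borel_measurable borel" using contF by (rule borel_measurable_continuous_onI)
  have "integrable lborel (\<lambda>x. indicator K x *\<^sub>R F x)"
    using K(1) contF continuous_on_subset by (blast intro: borel_integrable_compact)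
  moreover have "(\<lambda>x. indicator K x *\<^sub>R F x) = F"
    using K(2) by (auto simp: fun_eq_iff indicator_def)
  ultimately have Fint: "integrable lborel F" by simp
  have s0: "(\<integral>x. s n x \<partial>lborel) = 0" for n
    using integral_lborel_translation[OF Fm] Fint unfolding s_def by simp
  have "norm (s n x) \<le> w x" for n x
  proof (cases "x \<in> cball 0 (r + norm i)")
    case True
    have "\<exists>z>0. z < h n \<and> F (x + h n *\<^sub>R i) - F (x + 0 *\<^sub>R i) = (h n - 0) * F' (x + z *\<^sub>R i) i"
      by (rule MVT2[OF h(1)]) (rule has_derivative_line[OF F])
    then obtain z where "F (x + h n *\<^sub>R i) - F x = h n * F' (x + z *\<^sub>R i) i" by auto
    then have "s n x = F' (x + z *\<^sub>R i) i" using h(1)[of n] by (simp add: s_def)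
    then show ?thesis using M True by (simp add: w_def)
  next
    case False
    then have gt: "norm x > r + norm i" by simp
    have "norm (h n *\<^sub>R i) \<le> norm i" using h[of n] by (simp add: mult_left_le_one_le)
    then have "norm (x + h n *\<^sub>R i) > r" using gt norm_diff_ineq[of x "h n *\<^sub>R i"] by linarith
    then have "x + h n *\<^sub>R i \<notin> K" using r leD by blast
    moreover have "x \<notin> K" using gt r[of x] norm_ge_zero[of i] by fastforce
    ultimately show ?thesis using K(2) False by (simp add: s_def w_def)
  qed
  moreover have "(\<lambda>n. s n x) \<longlonglongrightarrow> F' x i" for x
  proof -
    have "((\<lambda>t. F (x + t *\<^sub>R i)) has_real_derivative F' x i) (at 0)"
      using has_derivative_line[of F "F' x" x 0 i] F by simp
    then have "(\<lambda>t. (F (x + t *\<^sub>R i) - F x) / t) \<midarrow>0\<rightarrow> F' x i"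
      by (simp add: has_field_derivative_iff)
    moreover have "filterlim h (at 0) sequentially"
    proof (rule filterlim_atI)
      show "h \<longlonglongrightarrow> 0" unfolding h_def by (rule LIMSEQ_inverse_real_of_nat)
      show "\<forall>\<^sub>F n in sequentially. h n \<noteq> 0" using h(1) by (simp add: less_imp_neq[symmetric])
    qed
    ultimately show ?thesis
      unfolding s_def by (rule filterlim_compose)
  qed
  moreover have "integrable lborel w"
    unfolding w_def by (intro integrable_mult_left) (auto intro!: integrable_real_indicator emeasure_bounded_finite)
  moreover have "(\<lambda>x. F' x i) \<in> borel_measurable lborel" "\<And>n. s n \<in> borel_measurable lborel"
    using cont Fm unfolding s_def by (auto intro: borel_measurable_continuous_onI)
  ultimately have lim: "integrable lborel (\<lambda>x. F' x i)"
    "(\<lambda>n. \<integral>x. s n x \<partial>lborel) \<longlonglongrightarrow> (\<integral>x. F' x i \<partial>lborel)"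
    by (auto intro!: integrable_dominated_convergence[where w=w and s=s]
        integral_dominated_convergence[where w=w])
  show "integrable lborel (\<lambda>x. F' x i)" by (rule lim)
  show "(\<integral>x. F' x i \<partial>lborel) = 0" using lim(2) by (simp add: s0 LIMSEQ_const_iff)
qed

text \<open>
  On an open set it suffices that the function is differentiable there: vanishing off a compact
  subset, it has derivative \<open>0\<close> at all other points.
\<close>

lemma integral_directional_derivative:
  fixes F :: "'a::euclidean_space \<Rightarrow> real"
  assumes S: "open S" and F: "\<And>x. x \<in> S \<Longrightarrow> (F has_derivative F' x) (at x)"
    and cont: "continuous_on S (\<lambda>x. F' x i)"
    and K: "compact K" "K \<subseteq> S" "\<And>x. x \<notin> K \<Longrightarrow> F x = 0"
  shows "integrable (lebesgue_on S) (\<lambda>x. F' x i)" "(LINT x|lebesgue_on S. F' x i) = 0"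
proof -
  define G where "G x = (if x \<in> S then F' x else (\<lambda>h. 0))" for x
  have G0: "(F has_derivative (\<lambda>h. 0)) (at x)" if "x \<notin> K" for x
    using has_derivative_zero_off_closed[of K F x] K that by (simp add: compact_imp_closed)
  have G: "(F has_derivative G x) (at x)" for x
    using F G0[of x] K(2) by (auto simp: G_def)
  have "continuous_on S (\<lambda>x. G x i)"
    using cont by (rule continuous_on_eq) (simp add: G_def)
  moreover have "G x i = 0" if "x \<notin> K" for x
    using has_derivative_unique[OF G G0] that by metis
  then have "continuous_on (- K) (\<lambda>x. G x i)"
    by (intro continuous_on_eq[OF continuous_on_const[of _ 0]]) simp
  ultimately have "continuous_on (S \<union> - K) (\<lambda>x. G x i)"
    using S K(1) by (intro continuous_on_open_Un) (auto simp: compact_imp_closed open_Compl)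
  moreover have "S \<union> - K = UNIV" using K(2) by auto
  ultimately have contG: "continuous_on UNIV (\<lambda>x. G x i)" by simp
  note lborel = integral_directional_derivative_lborel[OF G contG K(1,3)]
  have meas: "(\<lambda>x. G x i) \<in> borel_measurable lborel"
    using contG borel_measurable_continuous_onI by simp
  have eq: "(\<lambda>x. indicator S x * F' x i) = (\<lambda>x. G x i)"
    by (auto simp: G_def fun_eq_iff)
  show "integrable (lebesgue_on S) (\<lambda>x. F' x i)"
    using lborel(1) S meas
    by (subst integrable_restrict_space) (auto simp: eq integrable_completion)
  show "(LINT x|lebesgue_on S. F' x i) = 0"
    using lborel(2) S meas
    by (subst integral_restrict_space) (auto simp: eq integral_completion)
qed

section \<open>Test functions and weak derivatives\<close>

lemma test_functionsI:
  assumes "smooth \<phi>" "compact K" "K \<subseteq> S" "\<And>x. x \<notin> K \<Longrightarrow> \<phi> x = 0"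
  shows "\<phi> \<in> test_functions S"
proof -
  have "closure {x. \<phi> x \<noteq> 0} \<subseteq> K"
    by (rule closure_minimal) (use assms compact_imp_closed in blast)+
  moreover from this have "compact (closure {x. \<phi> x \<noteq> 0})"
    using compact_Int_closed[OF assms(2) closed_closure] by (metis inf.absorb2)
  ultimately show ?thesis
    using assms(1,3) unfolding test_functions_def by blast
qed

lemma test_functionsE:
  assumes "\<phi> \<in> test_functions S"
  obtains K where "smooth \<phi>" "compact K" "K \<subseteq> S" "\<And>x. x \<notin> K \<Longrightarrow> \<phi> x = 0"
proof
  show "smooth \<phi>" "compact (closure {x. \<phi> x \<noteq> 0})" "closure {x. \<phi> x \<noteq> 0} \<subseteq> S"
    using assms by (auto simp: test_functions_def)
  show "\<phi> x = 0" if "x \<notin> closure {x. \<phi> x \<noteq> 0}" for x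
    using that closure_subset[of "{x. \<phi> x \<noteq> 0}"] by auto
qed

lemma test_smooth: "\<phi> \<in> test_functions S \<Longrightarrow> smooth \<phi>"
  by (simp add: test_functions_def)

lemma test_pd: "\<phi> \<in> test_functions S \<Longrightarrow> i \<in> Basis \<Longrightarrow> pd i \<phi> \<in> test_functions S"
proof (elim test_functionsE)
  fix K assume *: "i \<in> Basis" "smooth \<phi>" "compact K" "K \<subseteq> S" "\<And>x. x \<notin> K \<Longrightarrow> \<phi> x = 0"
  then have "pd i \<phi> x = 0" if "x \<notin> K" for x
    using has_derivative_imp_pd[OF has_derivative_zero_off_closed[OF compact_imp_closed]] *(3,5) that
    by metis
  with * show "pd i \<phi> \<in> test_functions S"
    by (intro test_functionsI[of _ K] smooth_pd) auto
qed

lemma test_partials: "\<phi> \<in> test_functions S \<Longrightarrow> set is \<subseteq> Basis \<Longrightarrow> partials is \<phi> \<in> test_functions S"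
  by (induction "is") (simp_all add: partials_Cons test_pd del: partials.simps(2))

lemma test_mult_smooth:
  "\<phi> \<in> test_functions S \<Longrightarrow> smooth f \<Longrightarrow> (\<lambda>x. f x * \<phi> x) \<in> test_functions S"
proof (elim test_functionsE)
  fix K assume "smooth f" "smooth \<phi>" "compact K" "K \<subseteq> S" "\<And>x. x \<notin> K \<Longrightarrow> \<phi> x = 0"
  then show "(\<lambda>x. f x * \<phi> x) \<in> test_functions S"
    by (intro test_functionsI[of _ K] smooth_mult) auto
qed

lemma test_add:
  assumes "\<phi> \<in> test_functions S" "\<psi> \<in> test_functions S"
  shows "(\<lambda>x. \<phi> x + \<psi> x) \<in> test_functions S"
proof -
  obtain K L where "smooth \<phi>" "compact K" "K \<subseteq> S" "\<And>x. x \<notin> K \<Longrightarrow> \<phi> x = 0"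
    "smooth \<psi>" "compact L" "L \<subseteq> S" "\<And>x. x \<notin> L \<Longrightarrow> \<psi> x = 0"
    using assms by (elim test_functionsE) metis
  then show ?thesis
    by (intro test_functionsI[of _ "K \<union> L"] smooth_add) auto
qed

lemma integrable_mult_test:
  assumes "open S" "locally_integrable S u" "\<psi> \<in> test_functions S"
  shows "integrable (lebesgue_on S) (\<lambda>x. u x * \<psi> x)"
  using assms(3)
proof (elim test_functionsE)
  fix K assume "smooth \<psi>" "compact K" "K \<subseteq> S" "\<And>x. x \<notin> K \<Longrightarrow> \<psi> x = 0"
  then show ?thesis
    by (intro integrable_compactly_supported_mult[OF assms(1,2)] smooth_continuous_on)
qed

lemma integral_pd_test:
  assumes "open S" "\<phi> \<in> test_functions S" "i \<in> Basis"
  shows "integrable (lebesgue_on S) (pd i \<phi>)" "(LINT x|lebesgue_on S. pd i \<phi> x) = 0"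
proof -
  obtain K where K: "smooth \<phi>" "compact K" "K \<subseteq> S" "\<And>x. x \<notin> K \<Longrightarrow> \<phi> x = 0"
    using assms(2) by (elim test_functionsE) metis
  show "integrable (lebesgue_on S) (pd i \<phi>)" "(LINT x|lebesgue_on S. pd i \<phi> x) = 0"
    using integral_directional_derivative[OF assms(1) smooth_has_derivative[OF K(1)] _ K(2,3,4), of i]
      smooth_continuous_on[OF smooth_pd[OF K(1) assms(3)]] by auto
qed

lemma integration_by_parts_test:
  assumes S: "open S" and f: "smooth f" and \<psi>: "\<psi> \<in> test_functions S" and i: "i \<in> Basis"
  shows "(LINT x|lebesgue_on S. f x * pd i \<psi> x) = - (LINT x|lebesgue_on S. pd i f x * \<psi> x)"
proof -
  have "pd i (\<lambda>x. f x * \<psi> x) = (\<lambda>x. f x * pd i \<psi> x + pd i f x * \<psi> x)"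
    by (rule pd_mult[OF f test_smooth[OF \<psi>]])
  then have "(LINT x|lebesgue_on S. f x * pd i \<psi> x + pd i f x * \<psi> x) = 0"
    using integral_pd_test(2)[OF S test_mult_smooth[OF \<psi> f] i] by simp
  moreover have "integrable (lebesgue_on S) (\<lambda>x. f x * pd i \<psi> x)"
    using S f \<psi> i
    by (intro integrable_mult_test test_pd locally_integrable_continuous smooth_continuous_on)
  moreover have "integrable (lebesgue_on S) (\<lambda>x. pd i f x * \<psi> x)"
    using S f \<psi> i
    by (intro integrable_mult_test locally_integrable_continuous smooth_continuous_on smooth_pd)
  ultimately show ?thesis by simp
qed

text \<open>
  Integration by parts moves the outermost derivative of the test function first, so the derivatives
  arrive on \<open>f\<close> in reverse order; the symmetry of mixed derivatives restores the order of the list.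
\<close>

lemma smooth_has_weak_deriv:
  assumes S: "open S" and "smooth f" and "set is \<subseteq> Basis"
  shows "has_weak_deriv S is f (partials is f)"
proof -
  have "(LINT x|lebesgue_on S. f x * partials is \<phi> x) =
      (-1) ^ length is * (LINT x|lebesgue_on S. partials is f x * \<phi> x)"
    if "\<phi> \<in> test_functions S" for \<phi>
    using assms(2,3)
  proof (induction "is" arbitrary: f)
    case (Cons i "is")
    have "(LINT x|lebesgue_on S. f x * partials (i # is) \<phi> x)
        = - (LINT x|lebesgue_on S. pd i f x * partials is \<phi> x)"
      unfolding partials_Cons
      using Cons.prems that by (intro integration_by_parts_test S test_partials) auto
    also have "\<dots> = (-1) ^ length (i # is) * (LINT x|lebesgue_on S. partials is (pd i f) x * \<phi> x)"
      using Cons by (simp add: smooth_pd)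
    also have "partials is (pd i f) = partials (i # is) f"
      using Cons.prems pd_partials_commute[of f i "is"] by (simp add: partials_Cons del: partials.simps(2))
    finally show ?case .
  qed simp
  then show ?thesis
    using assms unfolding has_weak_deriv_def
    by (auto intro: locally_integrable_continuous smooth_continuous_on smooth_partials)
qed

section \<open>Uniqueness of weak derivatives\<close>

text \<open>
  Test against the bump functions of the box and pass to the limit by dominated convergence.
\<close>

lemma integral_cbox_eq_0_if_test_integrals_eq_0:
  fixes g :: "'a::euclidean_space \<Rightarrow> real"
  assumes S: "open S" and g: "locally_integrable S g"
    and zero: "\<And>\<phi>. \<phi> \<in> test_functions S \<Longrightarrow> (LINT x|lebesgue_on S. g x * \<phi> x) = 0"
    and cd: "cbox c d \<subseteq> S"
  shows "integral (cbox c d) g = 0"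
proof -
  have gi: "integrable (lebesgue_on (cbox c d)) g"
    using g cd unfolding locally_integrable_def by simp
  have off: "box_bump c d n x = 0" if "x \<notin> cbox c d" for n x
    using that box_bump_zero box_subset_cbox by blast
  have "(LINT x|lebesgue_on (cbox c d). g x * box_bump c d n x) = 0" for n
    using zero[OF box_bump_test[OF cd, of n]] S cd off
    by (subst (asm) integral_lebesgue_on_subset(1)[of S "cbox c d"]) auto
  moreover have "(\<lambda>n. LINT x|lebesgue_on (cbox c d). g x * box_bump c d n x)
      \<longlonglongrightarrow> (LINT x|lebesgue_on (cbox c d). g x * indicator (box c d) x)"
  proof (rule integral_dominated_convergence)
    show "integrable (lebesgue_on (cbox c d)) (\<lambda>x. \<bar>g x\<bar>)" using gi by simp
    show "(\<lambda>x. g x * box_bump c d n x) \<in> borel_measurable (lebesgue_on (cbox c d))" for n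
      by (intro borel_measurable_times borel_measurable_integrable[OF gi]
          continuous_imp_measurable_on_sets_lebesgue smooth_continuous_on smooth_box_bump) auto
    have "indicator (box c d) \<in> borel_measurable (lebesgue_on (cbox c d))"
      by (intro measurable_restrict_space1 borel_measurable_indicator) auto
    then show "(\<lambda>x. g x * indicator (box c d) x) \<in> borel_measurable (lebesgue_on (cbox c d))"
      by (intro borel_measurable_times borel_measurable_integrable[OF gi])
    show "AE x in lebesgue_on (cbox c d). (\<lambda>n. g x * box_bump c d n x) \<longlonglongrightarrow> g x * indicator (box c d) x"
      by (intro AE_I2 tendsto_intros box_bump_limit)
    show "AE x in lebesgue_on (cbox c d). norm (g x * box_bump c d n x) \<le> \<bar>g x\<bar>" for n
      using box_bump_bounds[of c d n] by (intro AE_I2) (simp add: abs_mult mult_left_le)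
  qed
  ultimately have "(LINT x|lebesgue_on (cbox c d). g x * indicator (box c d) x) = 0"
    by (simp add: LIMSEQ_const_iff)
  moreover have "box c d \<in> sets (lebesgue_on (cbox c d))"
    using box_subset_cbox by (subst sets_restrict_space_iff) auto
  then have "integrable (lebesgue_on (cbox c d)) (\<lambda>x. g x * indicator (box c d) x)"
    using gi by (rule integrable_real_mult_indicator)
  ultimately have "integral (cbox c d) (\<lambda>x. g x * indicator (box c d) x) = 0"
    by (simp add: lebesgue_integral_eq_integral)
  moreover have "integral (cbox c d) (\<lambda>x. g x * indicator (box c d) x) = integral (cbox c d) g"
    by (rule integral_spike[OF negligible_frontier_interval[of c d]]) auto
  ultimately show ?thesis by simp
qed

text \<open>
  The fundamental lemma of the calculus of variations. All integrals over small boxes vanish, hence by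
  Lebesgue's differentiation theorem, so does \<open>g\<close> at almost every point; countably many boxes exhaust \<open>S\<close>.
\<close>

lemma AE_eq_0_if_test_integrals_eq_0:
  fixes g :: "'a::euclidean_space \<Rightarrow> real"
  assumes S: "open S" and g: "locally_integrable S g"
    and zero: "\<And>\<phi>. \<phi> \<in> test_functions S \<Longrightarrow> (LINT x|lebesgue_on S. g x * \<phi> x) = 0"
  shows "AE x in lebesgue_on S. g x = 0"
proof -
  have local: "negligible {x \<in> cbox c d. g x \<noteq> 0}" if cd: "cbox c d \<subseteq> S" for c d
  proof -
    define f where "f x = (if x \<in> cbox c d then g x else 0)" for x
    have "integrable (lebesgue_on (cbox c d)) g"
      using g cd unfolding locally_integrable_def by simp
    then have "integrable lebesgue (\<lambda>x. indicator (cbox c d) x *\<^sub>R g x)"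
      by (subst (asm) integrable_restrict_space) auto
    moreover have "(\<lambda>x. indicator (cbox c d) x *\<^sub>R g x) = f"
      by (auto simp: f_def fun_eq_iff)
    ultimately have "integrable lebesgue f" by simp
    then have "f integrable_on cbox a b" for a b
      using integrable_on_lebesgue integrable_on_subcbox by blast
    then obtain N where N: "negligible N"
      "\<And>x e. \<lbrakk>x \<notin> N; 0 < e\<rbrakk> \<Longrightarrow> \<exists>\<delta>>0. \<forall>h. 0 < h \<and> h < \<delta> \<longrightarrow>
          norm (integral (cbox x (x + h *\<^sub>R One)) f /\<^sub>R h ^ DIM('a) - f x) < e"
      using integrable_ccontinuous_explicit by blast
    have "g x = 0" if x: "x \<in> box c d" "x \<notin> N" for x
    proof (rule ccontr)
      assume "g x \<noteq> 0"
      then obtain \<delta> where \<delta>: "\<delta> > 0" "\<And>h. 0 < h \<Longrightarrow> h < \<delta> \<Longrightarrow>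
          norm (integral (cbox x (x + h *\<^sub>R One)) f /\<^sub>R h ^ DIM('a) - f x) < \<bar>g x\<bar>"
        using N(2)[OF x(2), of "\<bar>g x\<bar>"] by auto
      \<comment> \<open>The boxes with lower corner \<open>x\<close> and side at most \<open>D\<close> stay inside \<open>cbox c d\<close>.\<close>
      define D where "D = Min ((\<lambda>i. (d - x) \<bullet> i) ` Basis)"
      have D: "D > 0" "\<And>i. i \<in> Basis \<Longrightarrow> D \<le> (d - x) \<bullet> i"
        using x(1) unfolding D_def by (auto simp: mem_box inner_diff_left)
      define h where "h = min D (\<delta> / 2)"
      have h: "0 < h" "h < \<delta>" "h \<le> D" using D \<delta> by (auto simp: h_def)
      have sub: "cbox x (x + h *\<^sub>R One) \<subseteq> cbox c d"
      proof
        fix y assume y: "y \<in> cbox x (x + h *\<^sub>R One)"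
        have "c \<bullet> i \<le> y \<bullet> i \<and> y \<bullet> i \<le> d \<bullet> i" if i: "i \<in> Basis" for i
        proof -
          have "x \<bullet> i \<le> y \<bullet> i" "y \<bullet> i \<le> x \<bullet> i + h"
            using y i by (auto simp: mem_box inner_add_left)
          moreover have "c \<bullet> i < x \<bullet> i" using x(1) i by (simp add: mem_box)
          moreover have "h \<le> d \<bullet> i - x \<bullet> i" using D(2)[OF i] h(3) by (simp add: inner_diff_left)
          ultimately show ?thesis by linarith
        qed
        then show "y \<in> cbox c d" by (simp add: mem_box)
      qed
      have "integral (cbox x (x + h *\<^sub>R One)) f = integral (cbox x (x + h *\<^sub>R One)) g"
        using sub by (intro Henstock_Kurzweil_Integration.integral_cong) (auto simp: f_def)
      also have "\<dots> = 0"
        using sub cd by (intro integral_cbox_eq_0_if_test_integrals_eq_0[OF S g zero]) auto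
      finally have "norm (f x) < \<bar>g x\<bar>" using \<delta>(2)[OF h(1,2)] by simp
      moreover have "x \<in> cbox c d" using x(1) box_subset_cbox by blast
      ultimately show False by (simp add: f_def)
    qed
    then have "{x \<in> cbox c d. g x \<noteq> 0} \<subseteq> N \<union> (cbox c d - box c d)" by blast
    then show ?thesis
      using negligible_subset negligible_Un[OF N(1) negligible_frontier_interval] by blast
  qed
  have "\<exists>\<D>. countable \<D> \<and> \<D> \<subseteq> Pow S \<and> (\<forall>X\<in>\<D>. \<exists>a b. X = cbox a b) \<and> \<Union>\<D> = S"
  proof (rule open_countable_Union_open_cbox[OF S])
    fix \<D> :: "'a set set"
    assume "countable \<D>" "\<D> \<subseteq> Pow S" "\<And>X. X \<in> \<D> \<Longrightarrow> \<exists>a b. X = cbox a b" "\<Union>\<D> = S"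
    then show ?thesis by (intro exI[of _ \<D>] conjI ballI)
  qed
  then obtain \<D> where \<D>: "countable \<D>" "\<D> \<subseteq> Pow S" "\<forall>X\<in>\<D>. \<exists>a b. X = cbox a b"
    "\<Union>\<D> = S"
    by blast
  have "negligible (\<Union>X\<in>\<D>. {x \<in> X. g x \<noteq> 0})"
  proof (rule negligible_countable_Union)
    show "countable ((\<lambda>X. {x \<in> X. g x \<noteq> 0}) ` \<D>)" using \<D>(1) by simp
    fix T assume "T \<in> (\<lambda>X. {x \<in> X. g x \<noteq> 0}) ` \<D>"
    then obtain X where X: "X \<in> \<D>" "T = {x \<in> X. g x \<noteq> 0}" by blast
    obtain a b where "X = cbox a b" using \<D>(3) X(1) by blast
    moreover have "X \<subseteq> S" using \<D>(2) X(1) by blast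
    ultimately show "negligible T" using local[of a b] X(2) by simp
  qed
  moreover have "(\<Union>X\<in>\<D>. {x \<in> X. g x \<noteq> 0}) = {x \<in> S. g x \<noteq> 0}" using \<D>(4) by blast
  ultimately have "{x \<in> S. g x \<noteq> 0} \<in> null_sets lebesgue"
    by (simp add: negligible_iff_null_sets)
  then have "AE x in lebesgue. x \<in> S \<longrightarrow> g x = 0"
    by (rule AE_I') auto
  then show ?thesis using S by (subst AE_restrict_space_iff) auto
qed

lemma locally_integrable_diff:
  "locally_integrable S f \<Longrightarrow> locally_integrable S g \<Longrightarrow> locally_integrable S (\<lambda>x. f x - g x)"
  by (simp add: locally_integrable_def)

lemma has_weak_deriv_diff:
  assumes S: "open S" and "set is \<subseteq> Basis"
    and u: "has_weak_deriv S is u v" and w: "has_weak_deriv S is w z"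
  shows "has_weak_deriv S is (\<lambda>x. u x - w x) (\<lambda>x. v x - z x)"
proof -
  have "(LINT x|lebesgue_on S. (u x - w x) * partials is \<phi> x) =
      (-1) ^ length is * (LINT x|lebesgue_on S. (v x - z x) * \<phi> x)"
    if \<phi>: "\<phi> \<in> test_functions S" for \<phi>
  proof -
    have "integrable (lebesgue_on S) (\<lambda>x. u x * partials is \<phi> x)"
      "integrable (lebesgue_on S) (\<lambda>x. w x * partials is \<phi> x)"
      "integrable (lebesgue_on S) (\<lambda>x. v x * \<phi> x)" "integrable (lebesgue_on S) (\<lambda>x. z x * \<phi> x)"
      using assms \<phi> unfolding has_weak_deriv_def by (auto intro!: integrable_mult_test test_partials)
    then show ?thesis
      using u w \<phi> unfolding has_weak_deriv_def by (simp add: left_diff_distrib right_diff_distrib)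
  qed
  then show ?thesis using u w unfolding has_weak_deriv_def by (auto intro: locally_integrable_diff)
qed

lemma has_weak_derivD:
  assumes "has_weak_deriv S is u v" "\<phi> \<in> test_functions S"
  shows "(LINT x|lebesgue_on S. u x * partials is \<phi> x) =
      (-1) ^ length is * (LINT x|lebesgue_on S. v x * \<phi> x)"
  using assms unfolding has_weak_deriv_def by blast

text \<open>
  Because of this uniqueness, facts about one weak derivative carry over to the representative chosen by
  \<^const>\<open>weak_deriv\<close>.
\<close>

lemma has_weak_deriv_unique:
  assumes S: "open S" and u: "has_weak_deriv S is u v" and w: "has_weak_deriv S is u w"
  shows "AE x in lebesgue_on S. v x = w x"
proof -
  have lv: "locally_integrable S v" and lw: "locally_integrable S w"
    using u w unfolding has_weak_deriv_def by auto
  have "(LINT x|lebesgue_on S. (v x - w x) * \<phi> x) = 0" if \<phi>: "\<phi> \<in> test_functions S" for \<phi>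
  proof -
    have "(-1) ^ length is * (LINT x|lebesgue_on S. v x * \<phi> x)
        = (-1) ^ length is * (LINT x|lebesgue_on S. w x * \<phi> x)"
      by (rule trans[OF has_weak_derivD[OF u \<phi>, symmetric] has_weak_derivD[OF w \<phi>]])
    then have "(LINT x|lebesgue_on S. v x * \<phi> x) = (LINT x|lebesgue_on S. w x * \<phi> x)" by simp
    then show ?thesis
      using integrable_mult_test[OF S lv \<phi>] integrable_mult_test[OF S lw \<phi>]
      by (simp add: left_diff_distrib)
  qed
  from AE_eq_0_if_test_integrals_eq_0[OF S locally_integrable_diff[OF lv lw] this]
  show ?thesis by (auto elim: eventually_mono)
qed

lemma has_weak_deriv_weak_deriv:
  "has_weak_deriv S is u v \<Longrightarrow> has_weak_deriv S is u (weak_deriv S is u)"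
  unfolding weak_deriv_def by (rule someI[of "has_weak_deriv S is u"])

section \<open>Convergence in the mean square\<close>

lemma square_integrable_AE_eq:
  assumes S: "open S" and f: "square_integrable S f" and ae: "AE x in lebesgue_on S. f x = g x"
  shows "square_integrable S g"
proof -
  have fm: "f \<in> borel_measurable (lebesgue_on S)" using f by (simp add: square_integrable_def)
  have Ss: "S \<in> sets lebesgue" using S by (simp add: sets_completionI_sets)
  have "AE x in lebesgue. (if x \<in> S then f x else 0) = (if x \<in> S then g x else 0)"
    using ae Ss by (subst (asm) AE_restrict_space_iff) auto
  then have "(\<lambda>x. if x \<in> S then g x else 0) \<in> borel_measurable lebesgue"
    by (rule borel_measurable_AE[OF borel_measurable_if_I[OF fm Ss]])
  then have gm: "g \<in> borel_measurable (lebesgue_on S)"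
    by (rule borel_measurable_if_D)
  moreover have "integrable (lebesgue_on S) (\<lambda>x. (g x)\<^sup>2)"
  proof (rule integrable_cong_AE_imp)
    show "integrable (lebesgue_on S) (\<lambda>x. (f x)\<^sup>2)" using f by (simp add: square_integrable_def)
    show "(\<lambda>x. (g x)\<^sup>2) \<in> borel_measurable (lebesgue_on S)" using gm by simp
    show "AE x in lebesgue_on S. (f x)\<^sup>2 = (g x)\<^sup>2" using ae by eventually_elim simp
  qed
  ultimately show ?thesis by (simp add: square_integrable_def)
qed

lemma square_integrable_mult_integrable:
  assumes "square_integrable S f" "square_integrable S g"
  shows "integrable (lebesgue_on S) (\<lambda>x. f x * g x)"
proof (rule Bochner_Integration.integrable_bound)
  show "integrable (lebesgue_on S) (\<lambda>x. (f x)\<^sup>2 + (g x)\<^sup>2)"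
    and "(\<lambda>x. f x * g x) \<in> borel_measurable (lebesgue_on S)"
    using assms by (auto simp: square_integrable_def)
  have "\<bar>p * q\<bar> \<le> p\<^sup>2 + q\<^sup>2" for p q :: real
  proof -
    have "0 \<le> (p + q)\<^sup>2" "0 \<le> (p - q)\<^sup>2" "0 \<le> p\<^sup>2" "0 \<le> q\<^sup>2" by simp_all
    then have "- (p * q) \<le> p\<^sup>2 + q\<^sup>2" "p * q \<le> p\<^sup>2 + q\<^sup>2"
      unfolding power2_sum power2_diff by linarith+
    then show ?thesis by (simp add: abs_le_iff)
  qed
  then show "AE x in lebesgue_on S. norm (f x * g x) \<le> norm ((f x)\<^sup>2 + (g x)\<^sup>2)"
    by (intro AE_I2) simp
qed

lemma square_integrable_add:
  assumes "square_integrable S f" "square_integrable S g"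
  shows "square_integrable S (\<lambda>x. f x + g x)"
  using assms square_integrable_mult_integrable[OF assms]
  by (auto simp: square_integrable_def power2_sum mult.assoc)

lemma square_integrable_diff:
  assumes "square_integrable S f" "square_integrable S g"
  shows "square_integrable S (\<lambda>x. f x - g x)"
  using assms square_integrable_mult_integrable[OF assms]
  by (auto simp: square_integrable_def power2_diff mult.assoc)

lemma square_integrable_bounded_mult:
  assumes c: "c \<in> borel_measurable (lebesgue_on S)" "\<And>x. x \<in> S \<Longrightarrow> \<bar>c x\<bar> \<le> M"
    and f: "square_integrable S f"
  shows "square_integrable S (\<lambda>x. c x * f x)"
    and "(LINT x|lebesgue_on S. (c x * f x)\<^sup>2) \<le> M\<^sup>2 * (LINT x|lebesgue_on S. (f x)\<^sup>2)"
proof -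
  have le: "(c x * f x)\<^sup>2 \<le> M\<^sup>2 * (f x)\<^sup>2" if "x \<in> S" for x
  proof -
    have "(c x)\<^sup>2 \<le> M\<^sup>2" using c(2)[OF that] by (simp add: abs_le_square_iff[symmetric])
    then show ?thesis by (simp add: power_mult_distrib mult_right_mono)
  qed
  have i: "integrable (lebesgue_on S) (\<lambda>x. M\<^sup>2 * (f x)\<^sup>2)"
    using f by (simp add: square_integrable_def)
  have m: "(\<lambda>x. c x * f x) \<in> borel_measurable (lebesgue_on S)"
    using c(1) f by (intro borel_measurable_times) (auto simp: square_integrable_def)
  have "integrable (lebesgue_on S) (\<lambda>x. (c x * f x)\<^sup>2)"
    by (rule Bochner_Integration.integrable_bound[OF i]) (use m le in \<open>auto intro!: AE_I2\<close>)
  then show si: "square_integrable S (\<lambda>x. c x * f x)"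
    using m by (simp add: square_integrable_def)
  have "(LINT x|lebesgue_on S. (c x * f x)\<^sup>2) \<le> (LINT x|lebesgue_on S. M\<^sup>2 * (f x)\<^sup>2)"
    using si i le by (intro integral_mono) (auto simp: square_integrable_def)
  then show "(LINT x|lebesgue_on S. (c x * f x)\<^sup>2) \<le> M\<^sup>2 * (LINT x|lebesgue_on S. (f x)\<^sup>2)"
    by simp
qed

lemma tendsto_0_squeeze:
  fixes f g :: "nat \<Rightarrow> real"
  assumes "\<And>n. 0 \<le> f n" "\<And>n. f n \<le> g n" "g \<longlonglongrightarrow> 0"
  shows "f \<longlonglongrightarrow> 0"
  using assms by (intro tendsto_sandwich[OF _ _ tendsto_const assms(3)]) simp_all

definition tends_in_L2 :: "'a::euclidean_space set \<Rightarrow> (nat \<Rightarrow> 'a \<Rightarrow> real) \<Rightarrow> ('a \<Rightarrow> real) \<Rightarrow> bool" where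
  "tends_in_L2 S f F \<longleftrightarrow> square_integrable S F \<and> (\<forall>n. square_integrable S (f n)) \<and>
    (\<lambda>n. LINT x|lebesgue_on S. (F x - f n x)\<^sup>2) \<longlonglongrightarrow> 0"

lemma tends_in_L2_add:
  assumes "tends_in_L2 S f F" "tends_in_L2 S g G"
  shows "tends_in_L2 S (\<lambda>n x. f n x + g n x) (\<lambda>x. F x + G x)"
proof -
  let ?I = "\<lambda>f n. LINT x|lebesgue_on S. (f n x)\<^sup>2"
  have sq: "square_integrable S F" "square_integrable S G"
    "\<And>n. square_integrable S (f n)" "\<And>n. square_integrable S (g n)"
    using assms by (auto simp: tends_in_L2_def)
  have le: "?I (\<lambda>n x. (F x + G x) - (f n x + g n x)) n
      \<le> 2 * ?I (\<lambda>n x. F x - f n x) n + 2 * ?I (\<lambda>n x. G x - g n x) n" for n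
  proof -
    have i: "integrable (lebesgue_on S) (\<lambda>x. (F x - f n x)\<^sup>2)"
      "integrable (lebesgue_on S) (\<lambda>x. (G x - g n x)\<^sup>2)"
      "integrable (lebesgue_on S) (\<lambda>x. ((F x + G x) - (f n x + g n x))\<^sup>2)"
      using square_integrable_diff[OF sq(1) sq(3)[of n]] square_integrable_diff[OF sq(2) sq(4)[of n]]
        square_integrable_diff[OF square_integrable_add[OF sq(1,2)] square_integrable_add[OF sq(3)[of n] sq(4)[of n]]]
      by (simp_all add: square_integrable_def)
    have "?I (\<lambda>n x. (F x + G x) - (f n x + g n x)) n
        \<le> (LINT x|lebesgue_on S. 2 * (F x - f n x)\<^sup>2 + 2 * (G x - g n x)\<^sup>2)"
    proof (rule integral_mono)
      fix x
      show "((F x + G x) - (f n x + g n x))\<^sup>2 \<le> 2 * (F x - f n x)\<^sup>2 + 2 * (G x - g n x)\<^sup>2"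
        using zero_le_power2[of "(F x - f n x) - (G x - g n x)"] by (simp add: power2_eq_square algebra_simps)
    qed (use i in auto)
    then show ?thesis using i by simp
  qed
  have "(\<lambda>n. 2 * ?I (\<lambda>n x. F x - f n x) n + 2 * ?I (\<lambda>n x. G x - g n x) n) \<longlonglongrightarrow> 2 * 0 + 2 * 0"
    using assms unfolding tends_in_L2_def by (intro tendsto_add tendsto_mult_left) auto
  then have "?I (\<lambda>n x. (F x + G x) - (f n x + g n x)) \<longlonglongrightarrow> 0"
    by - (rule tendsto_0_squeeze[OF _ le], simp_all)
  then show ?thesis
    using sq by (simp add: tends_in_L2_def square_integrable_add)
qed

lemma tends_in_L2_bounded_mult:
  assumes c: "c \<in> borel_measurable (lebesgue_on S)" "\<And>x. x \<in> S \<Longrightarrow> \<bar>c x\<bar> \<le> M"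
    and f: "tends_in_L2 S f F"
  shows "tends_in_L2 S (\<lambda>n x. c x * f n x) (\<lambda>x. c x * F x)"
proof -
  have sq: "square_integrable S F" "\<And>n. square_integrable S (f n)"
    and lim: "(\<lambda>n. LINT x|lebesgue_on S. (F x - f n x)\<^sup>2) \<longlonglongrightarrow> 0"
    using f by (auto simp: tends_in_L2_def)
  have "(LINT x|lebesgue_on S. (c x * F x - c x * f n x)\<^sup>2) \<le> M\<^sup>2 * (LINT x|lebesgue_on S. (F x - f n x)\<^sup>2)" for n
    using square_integrable_bounded_mult(2)[OF c square_integrable_diff[OF sq(1) sq(2)[of n]]]
    by (simp add: right_diff_distrib)
  moreover have "(\<lambda>n. M\<^sup>2 * (LINT x|lebesgue_on S. (F x - f n x)\<^sup>2)) \<longlonglongrightarrow> 0"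
    using tendsto_mult_left[OF lim, of "M\<^sup>2"] by simp
  ultimately have "(\<lambda>n. LINT x|lebesgue_on S. (c x * F x - c x * f n x)\<^sup>2) \<longlonglongrightarrow> 0"
    by - (rule tendsto_0_squeeze[of _ "\<lambda>n. M\<^sup>2 * (LINT x|lebesgue_on S. (F x - f n x)\<^sup>2)"], simp_all)
  then show ?thesis
    using sq square_integrable_bounded_mult(1)[OF c] by (simp add: tends_in_L2_def)
qed

text \<open>
  Since \<open>\<bar>q\<^sup>2 - p\<^sup>2\<bar> \<le> (1 + 1 / \<delta>) (p - q)\<^sup>2 + \<delta> p\<^sup>2\<close> for every \<open>\<delta> > 0\<close>, the integrals of the squares
  converge: the first term tends to \<open>0\<close> and the second is as small as desired.
\<close>

lemma tends_in_L2_integral: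
  assumes "tends_in_L2 S f F"
  shows "(\<lambda>n. LINT x|lebesgue_on S. (f n x)\<^sup>2) \<longlonglongrightarrow> (LINT x|lebesgue_on S. (F x)\<^sup>2)"
proof (rule LIMSEQ_I)
  fix e :: real assume e: "e > 0"
  have sq: "square_integrable S F" "\<And>n. square_integrable S (f n)"
    and lim: "(\<lambda>n. LINT x|lebesgue_on S. (F x - f n x)\<^sup>2) \<longlonglongrightarrow> 0"
    using assms by (auto simp: tends_in_L2_def)
  define J where "J = (LINT x|lebesgue_on S. (F x)\<^sup>2)"
  have J: "J \<ge> 0" by (simp add: J_def)
  define \<delta> where "\<delta> = e / (2 * (J + 1))"
  have \<delta>: "\<delta> > 0" "\<delta> * J \<le> e / 2"
    using e J by (auto simp: \<delta>_def field_simps)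
  define \<kappa> where "\<kappa> = 1 + 1 / \<delta>"
  have \<kappa>: "\<kappa> > 0" using \<delta> by (simp add: \<kappa>_def add_pos_pos)
  have "e / (2 * \<kappa>) > 0" using e \<kappa> by simp
  then obtain N where N: "\<And>n. n \<ge> N \<Longrightarrow> (LINT x|lebesgue_on S. (F x - f n x)\<^sup>2) < e / (2 * \<kappa>)"
    using LIMSEQ_D[OF lim] by fastforce
  show "\<exists>no. \<forall>n\<ge>no. norm ((LINT x|lebesgue_on S. (f n x)\<^sup>2) - (LINT x|lebesgue_on S. (F x)\<^sup>2)) < e"
  proof (intro exI allI impI)
    fix n assume n: "n \<ge> N"
    have i: "integrable (lebesgue_on S) (\<lambda>x. (F x - f n x)\<^sup>2)"
      "integrable (lebesgue_on S) (\<lambda>x. (f n x)\<^sup>2)" "integrable (lebesgue_on S) (\<lambda>x. (F x)\<^sup>2)"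
      using square_integrable_diff[OF sq(1) sq(2)[of n]] sq by (auto simp: square_integrable_def)
    have le: "\<bar>q\<^sup>2 - p\<^sup>2\<bar> \<le> \<kappa> * (p - q)\<^sup>2 + \<delta> * p\<^sup>2" for p q
    proof -
      have 1: "0 \<le> (sqrt \<delta> * p - (p - q) / sqrt \<delta>)\<^sup>2" "0 \<le> (sqrt \<delta> * p + (p - q) / sqrt \<delta>)\<^sup>2" by auto
      have "(sqrt \<delta> * p - (p - q) / sqrt \<delta>)\<^sup>2 = \<delta> * p\<^sup>2 + (p - q)\<^sup>2 / \<delta> - 2 * p * (p - q)"
        "(sqrt \<delta> * p + (p - q) / sqrt \<delta>)\<^sup>2 = \<delta> * p\<^sup>2 + (p - q)\<^sup>2 / \<delta> + 2 * p * (p - q)"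
        using \<delta> by (simp_all add: power2_sum power2_diff power_mult_distrib power_divide)
      with 1 have "\<bar>2 * p * (p - q)\<bar> \<le> \<delta> * p\<^sup>2 + (p - q)\<^sup>2 / \<delta>" by linarith
      moreover have eq: "q\<^sup>2 - p\<^sup>2 = (p - q)\<^sup>2 - 2 * p * (p - q)"
        by (simp add: power2_eq_square algebra_simps)
      have "\<bar>q\<^sup>2 - p\<^sup>2\<bar> \<le> \<bar>(p - q)\<^sup>2\<bar> + \<bar>2 * p * (p - q)\<bar>"
        unfolding eq by (rule abs_triangle_ineq4)
      ultimately show ?thesis by (simp add: \<kappa>_def distrib_right)
    qed
    have "\<bar>(LINT x|lebesgue_on S. (f n x)\<^sup>2) - J\<bar> = \<bar>LINT x|lebesgue_on S. (f n x)\<^sup>2 - (F x)\<^sup>2\<bar>"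
      using i by (simp add: J_def)
    also have "\<dots> \<le> (LINT x|lebesgue_on S. \<bar>(f n x)\<^sup>2 - (F x)\<^sup>2\<bar>)"
      by (rule integral_abs_bound)
    also have "\<dots> \<le> (LINT x|lebesgue_on S. \<kappa> * (F x - f n x)\<^sup>2 + \<delta> * (F x)\<^sup>2)"
      using i le by (intro integral_mono) auto
    also have "\<dots> = \<kappa> * (LINT x|lebesgue_on S. (F x - f n x)\<^sup>2) + \<delta> * J"
      using i by (simp add: J_def)
    also have "\<dots> < \<kappa> * (e / (2 * \<kappa>)) + e / 2"
      using N[OF n] \<delta> \<kappa> by (intro add_less_le_mono mult_strict_left_mono) auto
    also have "\<kappa> * (e / (2 * \<kappa>)) = e / 2"
      using \<kappa> by simp
    finally show "norm ((LINT x|lebesgue_on S. (f n x)\<^sup>2) - (LINT x|lebesgue_on S. (F x)\<^sup>2)) < e"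
      by (simp add: J_def)
  qed
qed

lemma square_integrable_test:
  assumes S: "open S" and \<phi>: "\<phi> \<in> test_functions S"
  shows "square_integrable S \<phi>"
  using integrable_mult_test[OF S _ \<phi>, of \<phi>] S
    smooth_continuous_on[OF test_smooth[OF \<phi>]]
  by (auto simp: square_integrable_def power2_eq_square locally_integrable_continuous
      intro!: continuous_imp_measurable_on_sets_lebesgue)

text \<open>
  One sequence of test functions approximates all weak derivatives up to order \<open>k\<close> simultaneously. Each
  derivative is controlled by a single summand of the Sobolev norm of the difference, once that
  summand is identified, almost everywhere, with the difference of the derivatives.
\<close>

lemma sobolev0_approximation:
  fixes u :: "'a::euclidean_space \<Rightarrow> real"
  assumes S: "open S" and u: "u \<in> sobolev0 k S"
  obtains \<phi> where "\<And>n. \<phi> n \<in> test_functions S"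
    and "\<And>is w. set is \<subseteq> Basis \<Longrightarrow> length is \<le> k \<Longrightarrow> has_weak_deriv S is u w \<Longrightarrow>
      tends_in_L2 S (\<lambda>n. partials is (\<phi> n)) w"
proof -
  have "\<exists>\<phi>\<in>test_functions S. sobolev_norm k S (\<lambda>x. u x - \<phi> x) < inverse (real (Suc n))" for n
    using u unfolding sobolev0_def by auto
  then obtain \<phi> where \<phi>: "\<And>n. \<phi> n \<in> test_functions S"
    and norm: "\<And>n. sobolev_norm k S (\<lambda>x. u x - \<phi> n x) < inverse (real (Suc n))"
    by metis
  have lim: "tends_in_L2 S (\<lambda>n. partials is (\<phi> n)) w"
    if "is": "set is \<subseteq> Basis" "length is \<le> k" and w: "has_weak_deriv S is u w" for "is" w
  proof -
    obtain v where v: "has_weak_deriv S is u v" "square_integrable S v"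
      using u "is" unfolding sobolev0_def sobolev_def by blast
    have wsq: "square_integrable S w"
      using square_integrable_AE_eq[OF S v(2) has_weak_deriv_unique[OF S v(1) w]] .
    have psq: "square_integrable S (partials is (\<phi> n))" for n
      by (intro square_integrable_test S test_partials \<phi> "is")
    have le: "(LINT x|lebesgue_on S. (w x - partials is (\<phi> n) x)\<^sup>2) \<le> (inverse (real (Suc n)))\<^sup>2" for n
    proof -
      let ?z = "weak_deriv S is (\<lambda>x. u x - \<phi> n x)"
      let ?I = "\<lambda>js. LINT x|lebesgue_on S. (weak_deriv S js (\<lambda>x. u x - \<phi> n x) x)\<^sup>2"
      let ?L = "{js. set js \<subseteq> (Basis :: 'a set) \<and> length js \<le> k}"
      have diff: "has_weak_deriv S is (\<lambda>x. u x - \<phi> n x) (\<lambda>x. w x - partials is (\<phi> n) x)"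
        by (intro has_weak_deriv_diff S "is" w smooth_has_weak_deriv test_smooth[OF \<phi>])
      have ae: "AE x in lebesgue_on S. w x - partials is (\<phi> n) x = ?z x"
        using has_weak_deriv_unique[OF S diff has_weak_deriv_weak_deriv[OF diff]] .
      have "square_integrable S ?z"
        by (rule square_integrable_AE_eq[OF S square_integrable_diff[OF wsq psq] ae])
      then have "(LINT x|lebesgue_on S. (w x - partials is (\<phi> n) x)\<^sup>2) = ?I is"
        using square_integrable_diff[OF wsq psq[of n]] ae unfolding square_integrable_def
        by (intro integral_cong_AE) (auto elim: eventually_mono)
      also have "?I is \<le> (\<Sum>js\<in>?L. ?I js)"
        using "is" by (intro member_le_sum finite_lists_length_le) auto
      also have "\<dots> = (sobolev_norm k S (\<lambda>x. u x - \<phi> n x))\<^sup>2"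
        unfolding sobolev_norm_def by (subst real_sqrt_pow2) (auto intro!: sum_nonneg)
      also have "\<dots> \<le> (inverse (real (Suc n)))\<^sup>2"
        using norm[of n] by (intro power_mono) (auto simp: sobolev_norm_def intro!: sum_nonneg)
      finally show ?thesis .
    qed
    have "(\<lambda>n. (inverse (real (Suc n)))\<^sup>2) \<longlonglongrightarrow> 0\<^sup>2"
      by (intro tendsto_intros LIMSEQ_inverse_real_of_nat)
    then have "(\<lambda>n. LINT x|lebesgue_on S. (w x - partials is (\<phi> n) x)\<^sup>2) \<longlonglongrightarrow> 0"
      using le by - (rule tendsto_0_squeeze[of _ "\<lambda>n. (inverse (real (Suc n)))\<^sup>2"], simp_all)
    then show ?thesis using wsq psq by (simp add: tends_in_L2_def)
  qed
  show thesis by (rule that[of \<phi>, OF \<phi> lim])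
qed

section \<open>The radial and the angular derivative in the plane\<close>

abbreviation e\<^sub>1 :: "real^2" where "e\<^sub>1 \<equiv> axis 1 1"
abbreviation e\<^sub>2 :: "real^2" where "e\<^sub>2 \<equiv> axis 2 1"

lemma sum_Basis_plane: "(\<Sum>i\<in>(Basis :: (real^2) set). f i) = f e\<^sub>1 + f e\<^sub>2"
proof -
  have B: "(Basis :: (real^2) set) = {e\<^sub>1, e\<^sub>2}"
    by (auto simp: Basis_vec_def UNIV_2)
  have "e\<^sub>1 \<noteq> e\<^sub>2" by (simp add: axis_eq_axis)
  then show ?thesis unfolding B by simp
qed

lemma Basis_plane: "e\<^sub>1 \<in> Basis" "e\<^sub>2 \<in> Basis"
  by (auto simp: axis_in_Basis_iff)

lemma inner_plane: "x \<bullet> y = x $ 1 * y $ 1 + x $ 2 * y $ 2" for x y :: "real^2"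
  by (simp add: inner_vec_def sum_2)

lemma axis_nth: "e\<^sub>1 $ 1 = 1" "e\<^sub>1 $ 2 = 0" "e\<^sub>2 $ 1 = 0" "e\<^sub>2 $ 2 = 1"
  by (simp_all add: axis_def)

lemma smooth_coordinate: "smooth (\<lambda>x :: real^2. x $ i)"
  using smooth_inner[of "axis i 1 :: real^2"] by (simp add: inner_axis inner_real_def)

lemma pd_coordinate: "pd v (\<lambda>x :: real^2. x $ i) = (\<lambda>x. v $ i)"
  using pd_inner[of v "axis i 1 :: real^2"] by (simp add: inner_axis inner_real_def)

lemma smooth_cmult: "smooth f \<Longrightarrow> smooth (\<lambda>x. c * f x)"
  by (intro smooth_mult smooth_const)

lemma pd_cmult: "smooth f \<Longrightarrow> pd i (\<lambda>x. c * f x) = (\<lambda>x. c * pd i f x)"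
  by (simp add: pd_mult[OF smooth_const] pd_const)

lemma smooth_diff: "smooth f \<Longrightarrow> smooth g \<Longrightarrow> smooth (\<lambda>x. f x - g x)"
  using smooth_add[of f "\<lambda>x. -1 * g x"] smooth_cmult[of g "-1"] by simp

lemma pd_diff: "smooth f \<Longrightarrow> smooth g \<Longrightarrow> pd i (\<lambda>x. f x - g x) = (\<lambda>x. pd i f x - pd i g x)"
  using pd_add[of f "\<lambda>x. -1 * g x" i] smooth_cmult[of g "-1"] pd_cmult[of g i "-1"] by simp

text \<open>
  In polar coordinates \<open>x = e\<^sup>t (cos \<theta>, sin \<theta>)\<close> these are \<open>\<partial>\<^sub>t - 1\<close> and \<open>\<partial>\<^sub>\<theta>\<close>. The shift by \<open>1\<close> compensates
  the weight \<open>1 / |x|\<^sup>4\<close> introduced below, for which it makes the radial operator skew-symmetric.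
\<close>

definition radial :: "(real^2 \<Rightarrow> real) \<Rightarrow> real^2 \<Rightarrow> real" where
  "radial f x = x $ 1 * pd e\<^sub>1 f x + x $ 2 * pd e\<^sub>2 f x - f x"

definition angular :: "(real^2 \<Rightarrow> real) \<Rightarrow> real^2 \<Rightarrow> real" where
  "angular f x = x $ 1 * pd e\<^sub>2 f x - x $ 2 * pd e\<^sub>1 f x"

lemma smooth_radial: "smooth f \<Longrightarrow> smooth (radial f)"
  unfolding radial_def[abs_def]
  by (intro smooth_diff smooth_add smooth_mult smooth_coordinate smooth_pd Basis_plane)

lemma smooth_angular: "smooth f \<Longrightarrow> smooth (angular f)"
  unfolding angular_def[abs_def]
  by (intro smooth_diff smooth_mult smooth_coordinate smooth_pd Basis_plane)

lemma test_cmult: "\<phi> \<in> test_functions S \<Longrightarrow> (\<lambda>x. c * \<phi> x) \<in> test_functions S"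
  by (rule test_mult_smooth[OF _ smooth_const])

lemma test_diff:
  "\<phi> \<in> test_functions S \<Longrightarrow> \<psi> \<in> test_functions S \<Longrightarrow> (\<lambda>x. \<phi> x - \<psi> x) \<in> test_functions S"
  using test_add[of \<phi> S "\<lambda>x. -1 * \<psi> x"] test_cmult[of \<psi> S "-1"] by simp

lemma test_radial: "\<phi> \<in> test_functions S \<Longrightarrow> radial \<phi> \<in> test_functions S"
  unfolding radial_def[abs_def]
  by (intro test_diff test_add test_mult_smooth smooth_coordinate test_pd Basis_plane)

lemma test_angular: "\<phi> \<in> test_functions S \<Longrightarrow> angular \<phi> \<in> test_functions S"
  unfolding angular_def[abs_def]
  by (intro test_diff test_mult_smooth smooth_coordinate test_pd Basis_plane)

lemma pd_radial:
  assumes "smooth f"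
  shows "pd e\<^sub>1 (radial f) x = x $ 1 * pd e\<^sub>1 (pd e\<^sub>1 f) x + x $ 2 * pd e\<^sub>1 (pd e\<^sub>2 f) x"
    and "pd e\<^sub>2 (radial f) x = x $ 1 * pd e\<^sub>2 (pd e\<^sub>1 f) x + x $ 2 * pd e\<^sub>2 (pd e\<^sub>2 f) x"
  using assms unfolding radial_def[abs_def]
  by (simp_all add: pd_diff pd_add pd_mult smooth_add smooth_mult smooth_coordinate smooth_pd
      Basis_plane pd_coordinate axis_nth)

lemma pd_angular:
  assumes "smooth f"
  shows "pd e\<^sub>1 (angular f) x = pd e\<^sub>2 f x + x $ 1 * pd e\<^sub>1 (pd e\<^sub>2 f) x - x $ 2 * pd e\<^sub>1 (pd e\<^sub>1 f) x"
    and "pd e\<^sub>2 (angular f) x = x $ 1 * pd e\<^sub>2 (pd e\<^sub>2 f) x - x $ 2 * pd e\<^sub>2 (pd e\<^sub>1 f) x - pd e\<^sub>1 f x"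
  using assms unfolding angular_def[abs_def]
  by (simp_all add: pd_diff pd_mult smooth_mult smooth_coordinate smooth_pd
      Basis_plane pd_coordinate axis_nth)

lemma radial_angular_commute:
  assumes "smooth f"
  shows "angular (radial f) = radial (angular f)"
proof
  fix x
  show "angular (radial f) x = radial (angular f) x"
    unfolding angular_def[of "radial f"] radial_def[of "angular f"]
    by (simp add: pd_radial[OF assms] pd_angular[OF assms] pd_commute[OF assms Basis_plane(2,1)] angular_def)
      (simp add: algebra_simps)
qed

lemma laplacian_polar:
  assumes "smooth f"
  shows "(x \<bullet> x) * (pd e\<^sub>1 (pd e\<^sub>1 f) x + pd e\<^sub>2 (pd e\<^sub>2 f) x)
    = radial (radial f) x + 2 * radial f x + f x + angular (angular f) x"
proof -
  have "radial (radial f) x = x $ 1 * pd e\<^sub>1 (radial f) x + x $ 2 * pd e\<^sub>2 (radial f) x - radial f x"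
    by (rule radial_def)
  moreover have "angular (angular f) x = x $ 1 * pd e\<^sub>2 (angular f) x - x $ 2 * pd e\<^sub>1 (angular f) x"
    by (rule angular_def)
  moreover have "radial f x = x $ 1 * pd e\<^sub>1 f x + x $ 2 * pd e\<^sub>2 f x - f x"
    by (rule radial_def)
  ultimately show ?thesis
    by (simp add: pd_radial[OF assms] pd_angular[OF assms] pd_commute[OF assms Basis_plane(2,1)] inner_plane)
      (simp add: algebra_simps)
qed

lemma gradient_polar:
  "(x \<bullet> x) * ((pd e\<^sub>1 f x)\<^sup>2 + (pd e\<^sub>2 f x)\<^sup>2) = (f x + radial f x)\<^sup>2 + (angular f x)\<^sup>2"
  unfolding radial_def angular_def inner_plane by (simp add: power2_eq_square algebra_simps)

section \<open>The inner product with weight \<open>1 / |x|\<^sup>4\<close>\<close>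

definition weighted_inner :: "(real^2) set \<Rightarrow> (real^2 \<Rightarrow> real) \<Rightarrow> (real^2 \<Rightarrow> real) \<Rightarrow> real" where
  "weighted_inner S f g = (LINT x|lebesgue_on S. f x * g x / (x \<bullet> x)\<^sup>2)"

text \<open>
  The vanishing integral of the \<open>j\<close>-th partial derivative of \<open>x\<^sub>i q / |x|\<^sup>4\<close>. Instead of passing to polar
  coordinates, the divergence theorem is applied to vector fields built from these functions.
\<close>

lemma weighted_coordinate_derivative:
  fixes S :: "(real^2) set" and i j :: 2
  assumes S: "open S" "0 \<notin> S"
    and q: "\<And>x. x \<in> S \<Longrightarrow> (q has_derivative q' x) (at x)"
    and cont: "continuous_on S (\<lambda>x. q' x (axis j 1))"
    and K: "compact K" "K \<subseteq> S" "\<And>x. x \<notin> K \<Longrightarrow> q x = 0"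
  defines "G \<equiv> \<lambda>x :: real^2. (axis j 1 $ i * q x + x $ i * q' x (axis j 1)) / (x \<bullet> x)\<^sup>2
      - 4 * x $ i * x $ j * q x / (x \<bullet> x) ^ 3"
  shows "integrable (lebesgue_on S) G" "(LINT x|lebesgue_on S. G x) = 0"
proof -
  define F where "F x = x $ i * q x / (x \<bullet> x)\<^sup>2" for x :: "real^2"
  define F' where "F' x h = (h $ i * q x + x $ i * q' x h) / (x \<bullet> x)\<^sup>2
      - 4 * x $ i * (x \<bullet> h) * q x / (x \<bullet> x) ^ 3" for x h :: "real^2"
  have nz: "x \<bullet> x \<noteq> 0" if "x \<in> S" for x using S(2) that by auto
  have F: "(F has_derivative F' x) (at x)" if x: "x \<in> S" for x
  proof -
    have w: "((\<lambda>x. inverse ((x \<bullet> x)\<^sup>2)) has_derivative (\<lambda>h. - 4 * (x \<bullet> h) / (x \<bullet> x) ^ 3)) (at x)"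
      using nz[OF x]
      by (auto intro!: derivative_eq_intros ext simp: inner_commute field_simps power2_eq_square power3_eq_cube)
    have n: "((\<lambda>x. x $ i) has_derivative (\<lambda>h. h $ i)) (at x)"
      by (rule bounded_linear_imp_has_derivative) (rule bounded_linear_vec_nth)
    have "((\<lambda>x. (x $ i * q x) * inverse ((x \<bullet> x)\<^sup>2)) has_derivative
        (\<lambda>h. (x $ i * q x) * (- 4 * (x \<bullet> h) / (x \<bullet> x) ^ 3) + (x $ i * q' x h + h $ i * q x) * inverse ((x \<bullet> x)\<^sup>2))) (at x)"
      by (intro has_derivative_mult w n q x)
    moreover have "(\<lambda>x. (x $ i * q x) * inverse ((x \<bullet> x)\<^sup>2)) = F"
      by (simp add: F_def fun_eq_iff divide_inverse)
    moreover have "(\<lambda>h. (x $ i * q x) * (- 4 * (x \<bullet> h) / (x \<bullet> x) ^ 3) + (x $ i * q' x h + h $ i * q x) * inverse ((x \<bullet> x)\<^sup>2)) = F' x"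
      by (simp add: F'_def fun_eq_iff divide_inverse algebra_simps)
    ultimately show ?thesis by simp
  qed
  have cq: "continuous_on S q"
    using q by (meson continuous_at_imp_continuous_on has_derivative_continuous)
  have "continuous_on S (\<lambda>x. F' x (axis j 1))"
    unfolding F'_def by (intro continuous_intros cont cq) (use nz in auto)
  note int = integral_directional_derivative[OF S(1) F this K(1,2)]
  have "F' x (axis j 1) = G x" for x
    by (simp add: F'_def G_def inner_axis inner_real_def)
  then show "integrable (lebesgue_on S) G" "(LINT x|lebesgue_on S. G x) = 0"
    using int K(3) by (simp_all add: F_def)
qed

text \<open>
  The two integrands are the divergences of \<open>x q / |x|\<^sup>4\<close> and of the rotated field
  \<open>(- x\<^sub>2, x\<^sub>1) q / |x|\<^sup>4\<close>. The term \<open>- 2 q\<close> is the sum of \<open>2 q\<close> from the divergence of \<open>x\<close> in the plane and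
  \<open>- 4 q\<close> from the weight.
\<close>

lemma weighted_divergence:
  fixes S :: "(real^2) set"
  assumes S: "open S" "0 \<notin> S"
    and q: "\<And>x. x \<in> S \<Longrightarrow> (q has_derivative q' x) (at x)"
    and cont: "\<And>j. continuous_on S (\<lambda>x. q' x (axis j 1))"
    and K: "compact K" "K \<subseteq> S" "\<And>x. x \<notin> K \<Longrightarrow> q x = 0"
  shows "integrable (lebesgue_on S) (\<lambda>x. (q' x x - 2 * q x) / (x \<bullet> x)\<^sup>2)"
    and "(LINT x|lebesgue_on S. (q' x x - 2 * q x) / (x \<bullet> x)\<^sup>2) = 0"
    and "integrable (lebesgue_on S) (\<lambda>x. (x $ 1 * q' x e\<^sub>2 - x $ 2 * q' x e\<^sub>1) / (x \<bullet> x)\<^sup>2)"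
    and "(LINT x|lebesgue_on S. (x $ 1 * q' x e\<^sub>2 - x $ 2 * q' x e\<^sub>1) / (x \<bullet> x)\<^sup>2) = 0"
proof -
  define G where "G i j x = (axis j 1 $ i * q x + x $ i * q' x (axis j 1)) / (x \<bullet> x)\<^sup>2
      - 4 * x $ i * x $ j * q x / (x \<bullet> x) ^ 3" for i j and x :: "real^2"
  have G: "integrable (lebesgue_on S) (G i j)" "(LINT x|lebesgue_on S. G i j x) = 0" for i j
    unfolding G_def[abs_def] by (rule weighted_coordinate_derivative[OF S q cont K]; assumption)+
  have "G 1 1 x + G 2 2 x = (q' x x - 2 * q x) / (x \<bullet> x)\<^sup>2" if x: "x \<in> S" for x
  proof -
    have "x = x $ 1 *\<^sub>R e\<^sub>1 + x $ 2 *\<^sub>R e\<^sub>2"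
      by (simp add: vec_eq_iff forall_2 axis_nth)
    then have "q' x x = q' x (x $ 1 *\<^sub>R e\<^sub>1 + x $ 2 *\<^sub>R e\<^sub>2)" by simp
    also have "\<dots> = x $ 1 * q' x e\<^sub>1 + x $ 2 * q' x e\<^sub>2"
      using has_derivative_linear[OF q[OF x]] by (simp add: linear_add linear_scale)
    finally have 1: "q' x x = x $ 1 * q' x e\<^sub>1 + x $ 2 * q' x e\<^sub>2" .
    have "x \<bullet> x \<noteq> 0" using x S(2) by auto
    then have "4 * x $ 1 * x $ 1 * q x / (x \<bullet> x) ^ 3 + 4 * x $ 2 * x $ 2 * q x / (x \<bullet> x) ^ 3 = 4 * q x / (x \<bullet> x)\<^sup>2"
      unfolding add_divide_distrib[symmetric]
      by (simp add: power2_eq_square power3_eq_cube frac_eq_eq) (simp add: inner_plane algebra_simps)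
    then show ?thesis by (simp add: G_def axis_nth 1 add_divide_distrib diff_divide_distrib)
  qed
  then have e: "(q' x x - 2 * q x) / (x \<bullet> x)\<^sup>2 = G 1 1 x + G 2 2 x" if "x \<in> space (lebesgue_on S)" for x
    using that by simp
  show "integrable (lebesgue_on S) (\<lambda>x. (q' x x - 2 * q x) / (x \<bullet> x)\<^sup>2)"
    by (rule iffD2[OF Bochner_Integration.integrable_cong[OF refl e]]) (simp_all add: G)
  show "(LINT x|lebesgue_on S. (q' x x - 2 * q x) / (x \<bullet> x)\<^sup>2) = 0"
    by (rule trans[OF Bochner_Integration.integral_cong[OF refl e]]) (simp_all add: G)
  have e': "(x $ 1 * q' x e\<^sub>2 - x $ 2 * q' x e\<^sub>1) / (x \<bullet> x)\<^sup>2 = G 1 2 x - G 2 1 x" for x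
    by (simp add: G_def axis_nth diff_divide_distrib)
  show "integrable (lebesgue_on S) (\<lambda>x. (x $ 1 * q' x e\<^sub>2 - x $ 2 * q' x e\<^sub>1) / (x \<bullet> x)\<^sup>2)"
    using G by (simp add: e')
  show "(LINT x|lebesgue_on S. (x $ 1 * q' x e\<^sub>2 - x $ 2 * q' x e\<^sub>1) / (x \<bullet> x)\<^sup>2) = 0"
    using G by (simp add: e')
qed

lemma smooth_has_derivative_plane:
  assumes "smooth f"
  shows "(f has_derivative (\<lambda>h. h $ 1 * pd e\<^sub>1 f x + h $ 2 * pd e\<^sub>2 f x)) (at x)"
proof -
  have lin: "linear (\<lambda>h. pd h f x)"
    by (rule has_derivative_linear[OF smooth_has_derivative[OF assms]])
  have "pd h f x = h $ 1 * pd e\<^sub>1 f x + h $ 2 * pd e\<^sub>2 f x" for h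
  proof -
    have "h = h $ 1 *\<^sub>R e\<^sub>1 + h $ 2 *\<^sub>R e\<^sub>2"
      by (simp add: vec_eq_iff forall_2 axis_nth)
    then have "pd h f x = pd (h $ 1 *\<^sub>R e\<^sub>1 + h $ 2 *\<^sub>R e\<^sub>2) f x" by simp
    also have "\<dots> = h $ 1 * pd e\<^sub>1 f x + h $ 2 * pd e\<^sub>2 f x"
      by (simp only: linear_add[OF lin] linear_scale[OF lin] real_scaleR_def)
    finally show ?thesis .
  qed
  then have eq: "(\<lambda>h. pd h f x) = (\<lambda>h. h $ 1 * pd e\<^sub>1 f x + h $ 2 * pd e\<^sub>2 f x)"
    by (rule ext)
  show ?thesis
    by (rule subst[of _ _ "\<lambda>D. (f has_derivative D) (at x)", OF eq]) (rule smooth_has_derivative[OF assms])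
qed

lemma weighted_integrable:
  assumes S: "open S" "(0 :: real^2) \<notin> S" and f: "smooth f" and g: "g \<in> test_functions S"
  shows "integrable (lebesgue_on S) (\<lambda>x. f x * g x / (x \<bullet> x)\<^sup>2)"
proof -
  have "continuous_on S (\<lambda>x. f x / (x \<bullet> x)\<^sup>2)"
    by (intro continuous_intros smooth_continuous_on f) (use S(2) in auto)
  from integrable_mult_test[OF S(1) locally_integrable_continuous[OF this] g]
  show ?thesis by simp
qed

lemma weighted_inner_commute: "weighted_inner S f g = weighted_inner S g f"
  unfolding weighted_inner_def by (simp add: mult.commute)

text \<open>
  Both identities say that the integral of a weighted divergence of the product \<open>f g\<close> vanishes; the term
  \<open>- 2 f g\<close> is shared equally by the two radial derivatives.
\<close>

lemma radial_angular_skew: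
  assumes S: "open S" "(0 :: real^2) \<notin> S" and f: "f \<in> test_functions S" and g: "g \<in> test_functions S"
  shows "weighted_inner S f (radial g) = - weighted_inner S (radial f) g"
    and "weighted_inner S f (angular g) = - weighted_inner S (angular f) g"
proof -
  have fs: "smooth f" "smooth (radial f)" "smooth (angular f)" and gs: "smooth g"
    using f g by (auto intro: test_smooth smooth_radial smooth_angular)
  define q' where "q' x h = f x * (h $ 1 * pd e\<^sub>1 g x + h $ 2 * pd e\<^sub>2 g x)
      + (h $ 1 * pd e\<^sub>1 f x + h $ 2 * pd e\<^sub>2 f x) * g x" for x h :: "real^2"
  obtain K where K: "compact K" "K \<subseteq> S" "\<And>x. x \<notin> K \<Longrightarrow> g x = 0"
    using g by (elim test_functionsE) metis
  have q: "((\<lambda>x. f x * g x) has_derivative q' x) (at x)" for x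
    unfolding q'_def by (intro has_derivative_mult smooth_has_derivative_plane fs gs)
  have cont: "continuous_on S (\<lambda>x. q' x (axis j 1))" for j
    unfolding q'_def by (intro continuous_intros smooth_continuous_on smooth_pd fs gs Basis_plane)
  have K0: "f x * g x = 0" if "x \<notin> K" for x using K(3)[OF that] by simp
  note div = weighted_divergence[OF S q cont K(1,2) K0]
  have "(q' x x - 2 * (f x * g x)) / (x \<bullet> x)\<^sup>2
      = f x * radial g x / (x \<bullet> x)\<^sup>2 + radial f x * g x / (x \<bullet> x)\<^sup>2" for x
    unfolding add_divide_distrib[symmetric] by (simp add: q'_def radial_def algebra_simps)
  then show "weighted_inner S f (radial g) = - weighted_inner S (radial f) g"
    using div(2) weighted_integrable[OF S fs(1) test_radial[OF g]] weighted_integrable[OF S fs(2) g]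
    by (simp add: weighted_inner_def)
  have "(x $ 1 * q' x e\<^sub>2 - x $ 2 * q' x e\<^sub>1) / (x \<bullet> x)\<^sup>2
      = f x * angular g x / (x \<bullet> x)\<^sup>2 + angular f x * g x / (x \<bullet> x)\<^sup>2" for x
    unfolding add_divide_distrib[symmetric] by (simp add: q'_def angular_def axis_nth algebra_simps)
  then show "weighted_inner S f (angular g) = - weighted_inner S (angular f) g"
    using div(4) weighted_integrable[OF S fs(1) test_angular[OF g]] weighted_integrable[OF S fs(3) g]
    by (simp add: weighted_inner_def)
qed

section \<open>The inequality for test functions\<close>

lemma open_annulus: "open (annulus a b)"
  unfolding annulus_def by (intro open_Diff open_ball closed_cball)

lemma mem_annulus: "x \<in> annulus a b \<longleftrightarrow> a < norm x \<and> norm x < b"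
  by (auto simp: annulus_def)

lemma zero_notin_annulus: "0 \<le> a \<Longrightarrow> 0 \<notin> annulus a b"
  by (simp add: mem_annulus)

text \<open>
  This is the one-dimensional Poincare inequality on an interval of length \<open>ln (b / a)\<close> in the variable
  \<open>t = ln |x|\<close>, for the function \<open>f / |x|\<close>, whose \<open>t\<close>-derivative is \<open>radial f / |x|\<close>. With \<open>\<mu> = \<pi> / ln (b / a)\<close>, the ground state \<open>sin (\<mu> (t - ln a))\<close> has the logarithmic
  derivative \<open>p = \<mu> cot (\<mu> (t - ln a))\<close>, which solves \<open>p' = - (\<mu>\<^sup>2 + p\<^sup>2)\<close>. Therefore
  \<open>(radial f)\<^sup>2 - \<mu>\<^sup>2 f\<^sup>2\<close> is the square \<open>(radial f - p f)\<^sup>2\<close> plus the weighted divergence belonging to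
  \<open>q = p f\<^sup>2\<close>.
\<close>

lemma weighted_poincare:
  assumes ab: "0 < a" "a < b" and f: "f \<in> test_functions (annulus a b)"
  shows "(pi / ln (b / a))\<^sup>2 * weighted_inner (annulus a b) f f
      \<le> weighted_inner (annulus a b) (radial f) (radial f)"
proof -
  define S where "S = annulus a b"
  define \<mu> where "\<mu> = pi / ln (b / a)"
  have S: "open S" "0 \<notin> S" using ab by (simp_all add: S_def open_annulus zero_notin_annulus)
  have f: "f \<in> test_functions S" using f by (simp add: S_def)
  have fs: "smooth f" "smooth (radial f)" using f by (auto intro: test_smooth smooth_radial)
  have T: "ln (b / a) > 0" using ab by simp
  have \<mu>: "\<mu> > 0" using T by (simp add: \<mu>_def)
  define \<theta> where "\<theta> x = \<mu> * (ln (x \<bullet> x) / 2 - ln a)" for x :: "real^2"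
  define p where "p x = \<mu> * cot (\<theta> x)" for x
  define p' where "p' x h = - (\<mu>\<^sup>2 + (p x)\<^sup>2) * (x \<bullet> h) / (x \<bullet> x)" for x h
  have sin: "sin (\<theta> x) > 0" and pos: "x \<bullet> x > 0" if x: "x \<in> S" for x
  proof -
    have n: "a < norm x" "norm x < b" using x by (auto simp: S_def mem_annulus)
    then show "x \<bullet> x > 0" using ab by auto
    have "ln (x \<bullet> x) = 2 * ln (norm x)"
      using n ab by (simp add: power2_norm_eq_inner[symmetric] ln_realpow)
    then have th: "\<theta> x = \<mu> * (ln (norm x) - ln a)" by (simp add: \<theta>_def)
    have "0 < norm x" using n ab by linarith
    then have "ln a < ln (norm x)" "ln (norm x) < ln b"
      using n ab by (simp_all only: ln_less_cancel_iff)
    then have "0 < \<theta> x" "\<theta> x < \<mu> * (ln b - ln a)" unfolding th using \<mu> by auto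
    moreover have "\<mu> * (ln b - ln a) = pi"
      using T ab by (simp add: \<mu>_def ln_div)
    ultimately show "sin (\<theta> x) > 0" by (simp add: sin_gt_zero)
  qed
  have p: "(p has_derivative p' x) (at x)" if x: "x \<in> S" for x
  proof -
    have "(\<theta> has_derivative (\<lambda>h. \<mu> * ((x \<bullet> h) / (x \<bullet> x)))) (at x)"
      unfolding \<theta>_def using pos[OF x]
      by (auto intro!: derivative_eq_intros ext simp: inner_commute field_simps)
    from DERIV_compose_FDERIV[OF DERIV_cot this]
    have "((\<lambda>x. cot (\<theta> x)) has_derivative
        (\<lambda>h. \<mu> * ((x \<bullet> h) / (x \<bullet> x)) * - inverse ((sin (\<theta> x))\<^sup>2))) (at x)"
      using sin[OF x] by simp
    then have "(p has_derivative (\<lambda>h. \<mu> * (\<mu> * ((x \<bullet> h) / (x \<bullet> x)) * - inverse ((sin (\<theta> x))\<^sup>2)))) (at x)"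
      unfolding p_def[abs_def] by (rule has_derivative_mult_right)
    moreover have inv: "inverse ((sin (\<theta> x))\<^sup>2) = 1 + (cot (\<theta> x))\<^sup>2"
      using sin[OF x] sin_cos_squared_add[of "\<theta> x"] by (simp add: cot_def power_divide field_simps)
    have "(\<lambda>h. \<mu> * (\<mu> * ((x \<bullet> h) / (x \<bullet> x)) * - inverse ((sin (\<theta> x))\<^sup>2))) = p' x"
      unfolding inv p'_def[abs_def] p_def
      by (simp add: divide_inverse power_mult_distrib power2_eq_square algebra_simps)
    ultimately show ?thesis by simp
  qed
  define q' where "q' x h = p x * (f x * (h $ 1 * pd e\<^sub>1 f x + h $ 2 * pd e\<^sub>2 f x)
      + (h $ 1 * pd e\<^sub>1 f x + h $ 2 * pd e\<^sub>2 f x) * f x) + p' x h * (f x * f x)" for x h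
  have q: "((\<lambda>x. p x * (f x * f x)) has_derivative q' x) (at x)" if "x \<in> S" for x
    unfolding q'_def by (intro has_derivative_mult smooth_has_derivative_plane fs p that)
  have nz: "x \<bullet> x \<noteq> 0" if "x \<in> S" for x using pos[OF that] by simp
  have cp: "continuous_on S p"
    using has_derivative_continuous[OF p] by (simp add: continuous_at_imp_continuous_on)
  have cf: "continuous_on S f" "continuous_on S (pd e\<^sub>1 f)" "continuous_on S (pd e\<^sub>2 f)"
    by (intro smooth_continuous_on smooth_pd fs Basis_plane)+
  have cont: "continuous_on S (\<lambda>x. q' x (axis j 1))" for j
    unfolding q'_def p'_def
    by (intro continuous_intros cp cf) (rule ballI, erule nz)
  obtain K where K: "compact K" "K \<subseteq> S" "\<And>x. x \<notin> K \<Longrightarrow> f x = 0"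
    using f by (elim test_functionsE) metis
  have K0: "p x * (f x * f x) = 0" if "x \<notin> K" for x using K(3)[OF that] by simp
  note div = weighted_divergence[OF S q cont K(1,2) K0]
  have int: "integrable (lebesgue_on S) (\<lambda>x. radial f x * radial f x / (x \<bullet> x)\<^sup>2)"
    "integrable (lebesgue_on S) (\<lambda>x. f x * f x / (x \<bullet> x)\<^sup>2)"
    using f fs by (auto intro!: weighted_integrable S test_radial)
  have "0 \<le> (LINT x|lebesgue_on S. radial f x * radial f x / (x \<bullet> x)\<^sup>2
      - \<mu>\<^sup>2 * (f x * f x / (x \<bullet> x)\<^sup>2) - (q' x x - 2 * (p x * (f x * f x))) / (x \<bullet> x)\<^sup>2)"
  proof (rule Bochner_Integration.integral_nonneg)
    fix x assume "x \<in> space (lebesgue_on S)"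
    then have "x \<bullet> x \<noteq> 0" using pos by force
    then have p'x: "p' x x = - (\<mu>\<^sup>2 + (p x)\<^sup>2)" by (simp add: p'_def)
    have "radial f x * radial f x - \<mu>\<^sup>2 * (f x * f x) - (q' x x - 2 * (p x * (f x * f x)))
        = (radial f x - p x * f x)\<^sup>2"
      by (simp add: q'_def p'x radial_def power2_eq_square algebra_simps)
    then have "radial f x * radial f x / (x \<bullet> x)\<^sup>2 - \<mu>\<^sup>2 * (f x * f x / (x \<bullet> x)\<^sup>2)
        - (q' x x - 2 * (p x * (f x * f x))) / (x \<bullet> x)\<^sup>2 = (radial f x - p x * f x)\<^sup>2 / (x \<bullet> x)\<^sup>2"
      by (metis (no_types, lifting) diff_divide_distrib times_divide_eq_right)
    then show "0 \<le> radial f x * radial f x / (x \<bullet> x)\<^sup>2 - \<mu>\<^sup>2 * (f x * f x / (x \<bullet> x)\<^sup>2)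
        - (q' x x - 2 * (p x * (f x * f x))) / (x \<bullet> x)\<^sup>2"
      by simp
  qed
  also have "\<dots> = weighted_inner S (radial f) (radial f) - \<mu>\<^sup>2 * weighted_inner S f f"
    using int div(1,2) by (simp add: weighted_inner_def del: times_divide_eq_right)
  finally show ?thesis unfolding S_def \<mu>_def by simp
qed

text \<open>
  On test functions \<open>\<delta> = radial\<close> and \<open>\<Theta> = angular\<close> are commuting skew-symmetric operators, so
  the cross terms of \<open>\<parallel>((\<delta> + m)\<^sup>2 + \<Theta>\<^sup>2) u\<parallel>\<^sup>2\<close> with an odd number of derivatives vanish and those with an even
  number have a sign: \<open>\<langle>\<delta>\<^sup>2 u, u\<rangle> = - \<parallel>\<delta> u\<parallel>\<^sup>2\<close> and \<open>\<langle>\<delta>\<^sup>2 u, \<Theta>\<^sup>2 u\<rangle> = \<parallel>\<delta> \<Theta> u\<parallel>\<^sup>2\<close>.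
  The product of \<open>m\<^sup>2 u\<close> and \<open>\<Theta>\<^sup>2 u\<close> stays inside the square \<open>\<parallel>m\<^sup>2 u + \<Theta>\<^sup>2 u\<parallel>\<^sup>2\<close>.
\<close>

lemma weighted_norm_identity:
  fixes m :: real
  assumes S: "open S" "(0 :: real^2) \<notin> S" and u: "u \<in> test_functions S"
  defines "B \<equiv> radial u" and "W \<equiv> angular u"
  defines "A \<equiv> radial B" and "Y \<equiv> radial W" and "Z \<equiv> angular W"
  defines "V \<equiv> \<lambda>x. m\<^sup>2 * u x + Z x"
  shows "(LINT x|lebesgue_on S. (A x + 2 * m * B x + m\<^sup>2 * u x + Z x)\<^sup>2 / (x \<bullet> x)\<^sup>2)
    = weighted_inner S A A + 2 * m\<^sup>2 * weighted_inner S B B + 2 * weighted_inner S Y Y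
      + weighted_inner S V V"
proof -
  note defs = A_def B_def W_def Y_def Z_def V_def
  have t: "u \<in> test_functions S" "B \<in> test_functions S" "W \<in> test_functions S" "A \<in> test_functions S"
    "Y \<in> test_functions S" "Z \<in> test_functions S" "V \<in> test_functions S"
    unfolding defs by (intro test_radial test_angular test_add test_cmult u)+
  note s = t[THEN test_smooth]
  note skew = radial_angular_skew[OF S]
  have YB: "angular B = Y"
    unfolding defs by (rule radial_angular_commute[OF test_smooth[OF u]])
  have YZ: "radial Z = angular Y"
    unfolding Y_def Z_def by (rule radial_angular_commute[symmetric, OF s(3)])
  have zero: "weighted_inner S (radial g) g = 0" if "g \<in> test_functions S" for g
    using skew(1)[OF that that] weighted_inner_commute[of S g "radial g"] by simp
  have AB: "weighted_inner S A B = 0" unfolding A_def by (rule zero[OF t(2)])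
  have Bu: "weighted_inner S B u = 0" unfolding B_def by (rule zero[OF t(1)])
  have Au: "weighted_inner S A u = - weighted_inner S B B"
    using skew(1)[OF t(2,1)] by (simp add: A_def B_def)
  have BZ: "weighted_inner S B Z = 0"
    using skew(2)[OF t(2,3)] zero[OF t(3)] by (simp add: YB Z_def[symmetric] Y_def)
  have AZ: "weighted_inner S A Z = weighted_inner S Y Y"
    using skew(1)[OF t(2,6)] skew(2)[OF t(2,5)] by (simp add: YB YZ A_def)
  define I where "I f g x = f x * g x / (x \<bullet> x)\<^sup>2" for f g :: "real^2 \<Rightarrow> real" and x
  have I: "integrable (lebesgue_on S) (I f g)" if "smooth f" "g \<in> test_functions S" for f g
    unfolding I_def[abs_def] using that by (rule weighted_integrable[OF S])
  have wi: "(LINT x|lebesgue_on S. I f g x) = weighted_inner S f g" for f g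
    by (simp add: weighted_inner_def I_def)
  have "(A x + 2 * m * B x + m\<^sup>2 * u x + Z x)\<^sup>2 / (x \<bullet> x)\<^sup>2
      = I A A x + 4 * m\<^sup>2 * I B B x + I V V x + 4 * m * I A B x + 2 * m\<^sup>2 * I A u x + 2 * I A Z x
        + 4 * m ^ 3 * I B u x + 4 * m * I B Z x" for x
  proof -
    have "(A x + 2 * m * B x + m\<^sup>2 * u x + Z x)\<^sup>2
      = A x * A x + 4 * m\<^sup>2 * (B x * B x) + V x * V x + 4 * m * (A x * B x) + 2 * m\<^sup>2 * (A x * u x)
        + 2 * (A x * Z x) + 4 * m ^ 3 * (B x * u x) + 4 * m * (B x * Z x)"
      unfolding V_def by (simp add: power2_eq_square power3_eq_cube algebra_simps)
    then show ?thesis by (simp add: I_def add_divide_distrib)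
  qed
  then have "(LINT x|lebesgue_on S. (A x + 2 * m * B x + m\<^sup>2 * u x + Z x)\<^sup>2 / (x \<bullet> x)\<^sup>2)
      = weighted_inner S A A + 4 * m\<^sup>2 * weighted_inner S B B + weighted_inner S V V
        + 4 * m * weighted_inner S A B + 2 * m\<^sup>2 * weighted_inner S A u + 2 * weighted_inner S A Z
        + 4 * m ^ 3 * weighted_inner S B u + 4 * m * weighted_inner S B Z"
    using I t s by (simp add: wi)
  then show ?thesis by (simp add: AB Bu Au BZ AZ)
qed

lemma weighted_gradient_identity:
  assumes S: "open S" "(0 :: real^2) \<notin> S" and u: "u \<in> test_functions S"
  shows "(LINT x|lebesgue_on S. ((pd e\<^sub>1 u x)\<^sup>2 + (pd e\<^sub>2 u x)\<^sup>2) / (x \<bullet> x))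
    = weighted_inner S u u + weighted_inner S (radial u) (radial u) + weighted_inner S (angular u) (angular u)"
proof -
  have s: "smooth u" "smooth (radial u)" "smooth (angular u)"
    using u by (auto intro: test_smooth smooth_radial smooth_angular)
  define I where "I f g x = f x * g x / (x \<bullet> x)\<^sup>2" for f g :: "real^2 \<Rightarrow> real" and x
  have I: "integrable (lebesgue_on S) (I f g)" if "smooth f" "g \<in> test_functions S" for f g
    unfolding I_def[abs_def] using that by (rule weighted_integrable[OF S])
  have wi: "(LINT x|lebesgue_on S. I f g x) = weighted_inner S f g" for f g
    by (simp add: weighted_inner_def I_def)
  have e: "((pd e\<^sub>1 u x)\<^sup>2 + (pd e\<^sub>2 u x)\<^sup>2) / (x \<bullet> x)
      = I u u x + 2 * I (radial u) u x + I (radial u) (radial u) x + I (angular u) (angular u) x"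
    if "x \<in> space (lebesgue_on S)" for x
  proof -
    have "x \<bullet> x \<noteq> 0" using that S(2) by auto
    then have "((pd e\<^sub>1 u x)\<^sup>2 + (pd e\<^sub>2 u x)\<^sup>2) / (x \<bullet> x)
        = (x \<bullet> x) * ((pd e\<^sub>1 u x)\<^sup>2 + (pd e\<^sub>2 u x)\<^sup>2) / (x \<bullet> x)\<^sup>2"
      by (simp add: power2_eq_square[of "x \<bullet> x"])
    also have "\<dots> = ((u x + radial u x)\<^sup>2 + (angular u x)\<^sup>2) / (x \<bullet> x)\<^sup>2"
      by (simp only: gradient_polar)
    also have "(u x + radial u x)\<^sup>2 + (angular u x)\<^sup>2
        = u x * u x + 2 * (radial u x * u x) + radial u x * radial u x + angular u x * angular u x"
      by (simp add: power2_eq_square algebra_simps)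
    finally show ?thesis by (simp add: I_def add_divide_distrib)
  qed
  have "weighted_inner S (radial u) u = 0"
    using radial_angular_skew(1)[OF S u u] weighted_inner_commute[of S u "radial u"] by simp
  moreover have "(LINT x|lebesgue_on S. ((pd e\<^sub>1 u x)\<^sup>2 + (pd e\<^sub>2 u x)\<^sup>2) / (x \<bullet> x))
      = weighted_inner S u u + 2 * weighted_inner S (radial u) u
        + weighted_inner S (radial u) (radial u) + weighted_inner S (angular u) (angular u)"
    by (rule trans[OF Bochner_Integration.integral_cong[OF refl e]])
      (simp_all add: I wi s u test_radial test_angular)
  ultimately show ?thesis by simp
qed

text \<open>
  Of the four squares in the expansion, the one that contains the pure angular derivative
  is dropped. The Poincare inequality, applied to \<open>u\<close>, \<open>\<delta> u\<close> and \<open>\<Theta> u\<close>, bounds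
  the other three from below by the three squares that make up the gradient term.
\<close>

lemma test_function_inequality:
  fixes m :: real
  assumes m: "m \<ge> 1" and ab: "0 < a" "a < b" and u: "u \<in> test_functions (annulus a b)"
    and c: "0 \<le> c" "c \<le> (pi / ln (b / a))\<^sup>2"
  shows "c * (LINT x|lebesgue_on (annulus a b). ((pd e\<^sub>1 u x)\<^sup>2 + (pd e\<^sub>2 u x)\<^sup>2) / (x \<bullet> x))
    \<le> (LINT x|lebesgue_on (annulus a b).
        (pd e\<^sub>1 (pd e\<^sub>1 u) x + pd e\<^sub>2 (pd e\<^sub>2 u) x
          + 2 * (m - 1) * (x $ 1 * pd e\<^sub>1 u x + x $ 2 * pd e\<^sub>2 u x) / (x \<bullet> x)
          + (m - 1)\<^sup>2 / (x \<bullet> x) * u x)\<^sup>2)"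
proof -
  define S where "S = annulus a b"
  define \<kappa> where "\<kappa> = (pi / ln (b / a))\<^sup>2"
  have S: "open S" "0 \<notin> S" using ab by (simp_all add: S_def open_annulus zero_notin_annulus)
  have u: "u \<in> test_functions S" using u by (simp add: S_def)
  define B where "B = radial u"
  define W where "W = angular u"
  define A where "A = radial B"
  define Y where "Y = radial W"
  define Z where "Z = angular W"
  define V where "V x = m\<^sup>2 * u x + Z x" for x
  have BW: "B \<in> test_functions S" "W \<in> test_functions S"
    unfolding B_def W_def by (intro test_radial test_angular u)+
  have poincare: "\<kappa> * weighted_inner S g g \<le> weighted_inner S (radial g) (radial g)"
    if "g \<in> test_functions S" for g
    using weighted_poincare[OF ab, of g] that by (simp add: S_def \<kappa>_def)
  have nonneg: "weighted_inner S g g \<ge> 0" for g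
    unfolding weighted_inner_def by (intro Bochner_Integration.integral_nonneg) simp
  have "c * (LINT x|lebesgue_on S. ((pd e\<^sub>1 u x)\<^sup>2 + (pd e\<^sub>2 u x)\<^sup>2) / (x \<bullet> x))
      = c * weighted_inner S u u + c * weighted_inner S B B + c * weighted_inner S W W"
    by (simp add: weighted_gradient_identity[OF S u] B_def W_def distrib_left)
  also have "\<dots> \<le> \<kappa> * weighted_inner S u u + \<kappa> * weighted_inner S B B + \<kappa> * weighted_inner S W W"
    using c nonneg by (intro add_mono mult_right_mono) (auto simp: \<kappa>_def)
  also have "\<dots> \<le> weighted_inner S B B + weighted_inner S A A + weighted_inner S Y Y"
    using poincare[OF u] poincare[OF BW(1)] poincare[OF BW(2)] unfolding A_def Y_def B_def[symmetric]
    by linarith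
  also have "\<dots> \<le> weighted_inner S A A + 2 * m\<^sup>2 * weighted_inner S B B + 2 * weighted_inner S Y Y
      + weighted_inner S V V"
  proof -
    have "1 \<le> 2 * m\<^sup>2" using m one_le_power[of m 2] by linarith
    then have "weighted_inner S B B \<le> 2 * m\<^sup>2 * weighted_inner S B B"
      using nonneg[of B] mult_right_mono[of 1 "2 * m\<^sup>2"] by fastforce
    then show ?thesis using nonneg[of Y] nonneg[of V] by linarith
  qed
  also have "\<dots> = (LINT x|lebesgue_on S. (A x + 2 * m * B x + m\<^sup>2 * u x + Z x)\<^sup>2 / (x \<bullet> x)\<^sup>2)"
    using weighted_norm_identity[OF S u, of m]
    by (simp add: A_def B_def W_def Y_def Z_def V_def[abs_def])
  also have "\<dots> = (LINT x|lebesgue_on S. (pd e\<^sub>1 (pd e\<^sub>1 u) x + pd e\<^sub>2 (pd e\<^sub>2 u) x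
          + 2 * (m - 1) * (x $ 1 * pd e\<^sub>1 u x + x $ 2 * pd e\<^sub>2 u x) / (x \<bullet> x)
          + (m - 1)\<^sup>2 / (x \<bullet> x) * u x)\<^sup>2)"
  proof (rule Bochner_Integration.integral_cong[OF refl])
    fix x assume "x \<in> space (lebesgue_on S)"
    then have nz: "x \<bullet> x \<noteq> 0" using S(2) by auto
    let ?L = "pd e\<^sub>1 (pd e\<^sub>1 u) x + pd e\<^sub>2 (pd e\<^sub>2 u) x"
    let ?D = "x $ 1 * pd e\<^sub>1 u x + x $ 2 * pd e\<^sub>2 u x"
    have D: "?D = B x + u x" by (simp add: B_def radial_def)
    have "A x + 2 * m * B x + m\<^sup>2 * u x + Z x
        = (A x + 2 * B x + u x + Z x) + 2 * (m - 1) * (B x + u x) + (m - 1)\<^sup>2 * u x"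
      by (simp add: power2_eq_square algebra_simps)
    also have "A x + 2 * B x + u x + Z x = (x \<bullet> x) * ?L"
      using laplacian_polar[OF test_smooth[OF u], of x] by (simp add: A_def B_def Z_def W_def)
    also have "(x \<bullet> x) * ?L + 2 * (m - 1) * (B x + u x) + (m - 1)\<^sup>2 * u x
        = (x \<bullet> x) * (?L + 2 * (m - 1) * (B x + u x) / (x \<bullet> x) + (m - 1)\<^sup>2 / (x \<bullet> x) * u x)"
    proof -
      have "r * (l + k / r + n / r * t) = r * l + k + n * t" if "r \<noteq> 0" for r l k n t :: real
        using that by (simp add: distrib_left)
      from this[OF nz] show ?thesis by simp
    qed
    finally have "A x + 2 * m * B x + m\<^sup>2 * u x + Z x
        = (x \<bullet> x) * (?L + 2 * (m - 1) * ?D / (x \<bullet> x) + (m - 1)\<^sup>2 / (x \<bullet> x) * u x)"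
      by (simp only: D)
    then show "(A x + 2 * m * B x + m\<^sup>2 * u x + Z x)\<^sup>2 / (x \<bullet> x)\<^sup>2
        = (?L + 2 * (m - 1) * ?D / (x \<bullet> x) + (m - 1)\<^sup>2 / (x \<bullet> x) * u x)\<^sup>2"
      using nz by (simp add: power_mult_distrib)
  qed
  finally show ?thesis unfolding S_def .
qed

section \<open>Passage to the Sobolev space\<close>

lemma sobolev0_weak_derivs:
  assumes "u \<in> sobolev0 k S" "set is \<subseteq> Basis" "length is \<le> k"
  shows "has_weak_deriv S is u (weak_deriv S is u)"
  using assms has_weak_deriv_weak_deriv unfolding sobolev0_def sobolev_def by blast

lemma sobolev0_has_weak_deriv_Nil:
  assumes "u \<in> sobolev0 k S"
  shows "has_weak_deriv S [] u u"
  using sobolev0_weak_derivs[OF assms, of "[]"] by (simp add: has_weak_deriv_def)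

theorem corollary1p3:
  fixes m :: real
  assumes "m \<ge> 1"
  shows "\<exists>R :: real. \<forall>a b :: real. 0 < a \<longrightarrow> a < b \<longrightarrow> ln (b / a) \<ge> R \<longrightarrow>
    (\<forall>u \<in> sobolev0 2 (annulus a b).
      (LINT x|lebesgue_on (annulus a b).
         (weak_laplacian (annulus a b) u x
          + 2 * (m - 1) * ((x /\<^sub>R (norm x)\<^sup>2) \<bullet> weak_gradient (annulus a b) u x)
          + (m - 1)\<^sup>2 / (norm x)\<^sup>2 * u x)\<^sup>2)
      \<ge> ((4 * m\<^sup>2 + pi\<^sup>2 / (ln (b / a))\<^sup>2) * (pi\<^sup>2 / (ln (b / a))\<^sup>2))
          / (4 * (m\<^sup>2 + 1) + 2 * pi\<^sup>2 / (ln (b / a))\<^sup>2)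
        * (LINT x|lebesgue_on (annulus a b).
             (norm (weak_gradient (annulus a b) u x))\<^sup>2 / (norm x)\<^sup>2))"
  \<comment> \<open>The threshold is \<open>0\<close> because the constant is at most \<open>(\<pi> / ln (b / a))\<^sup>2\<close> for every \<open>b > a\<close>.\<close>
proof (intro exI[of _ 0] allI impI ballI)
  fix a b :: real and u
  assume ab: "0 < a" "a < b"
  define S where "S = annulus a b"
  define lam where "lam = pi\<^sup>2 / (ln (b / a))\<^sup>2"
  define c where "c = ((4 * m\<^sup>2 + lam) * lam) / (4 * (m\<^sup>2 + 1) + 2 * lam)"
  assume "u \<in> sobolev0 2 (annulus a b)"
  then have u: "u \<in> sobolev0 2 S" by (simp add: S_def)
  have S: "open S" by (simp add: S_def open_annulus)
  then have Ss: "S \<in> sets lebesgue" by (simp add: sets_completionI_sets)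
  have c: "0 \<le> c" "c \<le> (pi / ln (b / a))\<^sup>2"
  proof -
    have lam: "lam \<ge> 0" by (simp add: lam_def)
    then show "0 \<le> c" by (simp add: c_def)
    have "(4 * m\<^sup>2 + lam) * lam \<le> lam * (4 * (m\<^sup>2 + 1) + 2 * lam)"
      using lam by (subst mult.commute) (intro mult_left_mono, auto)
    moreover have "0 < 4 * (m\<^sup>2 + 1) + 2 * lam"
      using lam by (intro add_pos_nonneg) (auto intro: add_nonneg_pos)
    ultimately have "c \<le> lam"
      unfolding c_def by (simp only: pos_divide_le_eq)
    then show "c \<le> (pi / ln (b / a))\<^sup>2" by (simp add: lam_def power_divide)
  qed
  \<comment> \<open>Both sides are integrals of squares of first-order or second-order expressions in \<open>u\<close> with
    coefficients that are bounded on the annulus; they are limits of the same integrals for test functions.\<close>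
  obtain \<phi> where \<phi>: "\<And>n. \<phi> n \<in> test_functions S"
    and lim: "\<And>is w. set is \<subseteq> Basis \<Longrightarrow> length is \<le> 2 \<Longrightarrow> has_weak_deriv S is u w \<Longrightarrow>
      tends_in_L2 S (\<lambda>n. partials is (\<phi> n)) w"
    by (rule sobolev0_approximation[OF S u]) blast
  define D where "D is = weak_deriv S is u" for "is"
  have lim0: "tends_in_L2 S \<phi> u"
    using lim[OF _ _ sobolev0_has_weak_deriv_Nil[OF u]] by simp
  have lim1: "tends_in_L2 S (\<lambda>n. pd i (\<phi> n)) (D [i])" if "i \<in> Basis" for i
    using lim[OF _ _ sobolev0_weak_derivs[OF u], of "[i]"] that
    by (simp add: partials_Cons D_def del: partials.simps(2))
  have lim2: "tends_in_L2 S (\<lambda>n. pd i (pd i (\<phi> n))) (D [i, i])" if "i \<in> Basis" for i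
    using lim[OF _ _ sobolev0_weak_derivs[OF u], of "[i, i]"] that
    by (simp add: partials_Cons D_def del: partials.simps(2))
  have bounds: "a < norm x" "norm x < b" if "x \<in> S" for x
    using that by (auto simp: S_def mem_annulus)
  have cont: "g \<in> borel_measurable (lebesgue_on S)" if "continuous_on S g" for g :: "real^2 \<Rightarrow> real"
    using continuous_imp_measurable_on_sets_lebesgue[OF that Ss] .
  have nz: "norm x \<noteq> 0" if "x \<in> S" for x using bounds(1)[OF that] ab by auto
  define k where "k i x = 2 * (m - 1) * (x $ i) / (norm x)\<^sup>2" for i :: 2 and x :: "real^2"
  have k: "k i \<in> borel_measurable (lebesgue_on S)" "\<And>x. x \<in> S \<Longrightarrow> \<bar>k i x\<bar> \<le> 2 * (m - 1) * b / a\<^sup>2" for i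
  proof -
    show "k i \<in> borel_measurable (lebesgue_on S)"
      unfolding k_def by (intro cont continuous_intros) (use nz in auto)
    fix x assume x: "x \<in> S"
    have "\<bar>x $ i\<bar> \<le> b" using component_le_norm_cart[of x i] bounds(2)[OF x] by linarith
    moreover have "a\<^sup>2 \<le> (norm x)\<^sup>2" using bounds(1)[OF x] ab by (intro power_mono) auto
    ultimately show "\<bar>k i x\<bar> \<le> 2 * (m - 1) * b / a\<^sup>2"
      unfolding k_def using assms ab by (auto simp: abs_mult intro!: frac_le mult_left_mono)
  qed
  define l where "l x = (m - 1)\<^sup>2 / (norm x)\<^sup>2" for x :: "real^2"
  have l: "l \<in> borel_measurable (lebesgue_on S)" "\<And>x. x \<in> S \<Longrightarrow> \<bar>l x\<bar> \<le> (m - 1)\<^sup>2 / a\<^sup>2"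
  proof -
    show "l \<in> borel_measurable (lebesgue_on S)"
      unfolding l_def by (intro cont continuous_intros) (use nz in auto)
    fix x assume x: "x \<in> S"
    have "a\<^sup>2 \<le> (norm x)\<^sup>2" using bounds(1)[OF x] ab by (intro power_mono) auto
    then show "\<bar>l x\<bar> \<le> (m - 1)\<^sup>2 / a\<^sup>2"
      unfolding l_def using ab by (auto intro!: frac_le)
  qed
  define r where "r x = 1 / norm x" for x :: "real^2"
  have r: "r \<in> borel_measurable (lebesgue_on S)" "\<And>x. x \<in> S \<Longrightarrow> \<bar>r x\<bar> \<le> 1 / a"
  proof -
    show "r \<in> borel_measurable (lebesgue_on S)"
      unfolding r_def by (intro cont continuous_intros) (use nz in auto)
    fix x assume x: "x \<in> S"
    show "\<bar>r x\<bar> \<le> 1 / a"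
      unfolding r_def using ab bounds(1)[OF x] by (auto intro!: frac_le)
  qed
  have F: "tends_in_L2 S
      (\<lambda>n x. pd e\<^sub>1 (pd e\<^sub>1 (\<phi> n)) x + pd e\<^sub>2 (pd e\<^sub>2 (\<phi> n)) x
        + (k 1 x * pd e\<^sub>1 (\<phi> n) x + k 2 x * pd e\<^sub>2 (\<phi> n) x) + l x * \<phi> n x)
      (\<lambda>x. D [e\<^sub>1, e\<^sub>1] x + D [e\<^sub>2, e\<^sub>2] x + (k 1 x * D [e\<^sub>1] x + k 2 x * D [e\<^sub>2] x) + l x * u x)"
    by (intro tends_in_L2_add tends_in_L2_bounded_mult[OF k] tends_in_L2_bounded_mult[OF l]
        lim0 lim1 lim2 Basis_plane)
  have G: "tends_in_L2 S (\<lambda>n x. r x * pd i (\<phi> n) x) (\<lambda>x. r x * D [i] x)" if "i \<in> Basis" for i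
    by (intro tends_in_L2_bounded_mult[OF r] lim1 that)
  have Gsq: "integrable (lebesgue_on S) (\<lambda>x. (r x * D [i] x)\<^sup>2)"
    "\<And>n. integrable (lebesgue_on S) (\<lambda>x. (r x * pd i (\<phi> n) x)\<^sup>2)" if "i \<in> Basis" for i
    using G[OF that] by (auto simp: tends_in_L2_def square_integrable_def)
  have le: "c * ((LINT x|lebesgue_on S. (r x * pd e\<^sub>1 (\<phi> n) x)\<^sup>2) + (LINT x|lebesgue_on S. (r x * pd e\<^sub>2 (\<phi> n) x)\<^sup>2))
    \<le> (LINT x|lebesgue_on S. (pd e\<^sub>1 (pd e\<^sub>1 (\<phi> n)) x + pd e\<^sub>2 (pd e\<^sub>2 (\<phi> n)) x
        + (k 1 x * pd e\<^sub>1 (\<phi> n) x + k 2 x * pd e\<^sub>2 (\<phi> n) x) + l x * \<phi> n x)\<^sup>2)" for n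
  proof -
    have grad: "(LINT x|lebesgue_on S. (r x * pd e\<^sub>1 (\<phi> n) x)\<^sup>2) + (LINT x|lebesgue_on S. (r x * pd e\<^sub>2 (\<phi> n) x)\<^sup>2)
      = (LINT x|lebesgue_on S. ((pd e\<^sub>1 (\<phi> n) x)\<^sup>2 + (pd e\<^sub>2 (\<phi> n) x)\<^sup>2) / (x \<bullet> x))"
      using Gsq(2)[OF Basis_plane(1), of n] Gsq(2)[OF Basis_plane(2), of n]
      by (subst Bochner_Integration.integral_add[symmetric])
         (auto simp: r_def power_mult_distrib power_divide power2_norm_eq_inner add_divide_distrib)
    have oper: "(pd e\<^sub>1 (pd e\<^sub>1 (\<phi> n)) x + pd e\<^sub>2 (pd e\<^sub>2 (\<phi> n)) x
        + (k 1 x * pd e\<^sub>1 (\<phi> n) x + k 2 x * pd e\<^sub>2 (\<phi> n) x) + l x * \<phi> n x)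
      = pd e\<^sub>1 (pd e\<^sub>1 (\<phi> n)) x + pd e\<^sub>2 (pd e\<^sub>2 (\<phi> n)) x
          + 2 * (m - 1) * (x $ 1 * pd e\<^sub>1 (\<phi> n) x + x $ 2 * pd e\<^sub>2 (\<phi> n) x) / (x \<bullet> x)
          + (m - 1)\<^sup>2 / (x \<bullet> x) * \<phi> n x" for x
      by (simp add: k_def l_def power2_norm_eq_inner add_divide_distrib distrib_left mult.assoc)
    show ?thesis
      unfolding grad oper
      by (rule test_function_inequality[OF assms ab \<phi>[of n, unfolded S_def] c, folded S_def])
  qed
  have wg: "weak_gradient S u x = D [e\<^sub>1] x *\<^sub>R e\<^sub>1 + D [e\<^sub>2] x *\<^sub>R e\<^sub>2" for x
    by (simp add: weak_gradient_def sum_Basis_plane D_def)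
  have "c * ((LINT x|lebesgue_on S. (r x * D [e\<^sub>1] x)\<^sup>2) + (LINT x|lebesgue_on S. (r x * D [e\<^sub>2] x)\<^sup>2))
    \<le> (LINT x|lebesgue_on S. (D [e\<^sub>1, e\<^sub>1] x + D [e\<^sub>2, e\<^sub>2] x
        + (k 1 x * D [e\<^sub>1] x + k 2 x * D [e\<^sub>2] x) + l x * u x)\<^sup>2)"
    by (rule LIMSEQ_le[OF tendsto_mult_left[OF tendsto_add[OF tends_in_L2_integral[OF G[OF Basis_plane(1)]]
          tends_in_L2_integral[OF G[OF Basis_plane(2)]]]] tends_in_L2_integral[OF F]])
      (use le in blast)
  also have "(LINT x|lebesgue_on S. (D [e\<^sub>1, e\<^sub>1] x + D [e\<^sub>2, e\<^sub>2] x
        + (k 1 x * D [e\<^sub>1] x + k 2 x * D [e\<^sub>2] x) + l x * u x)\<^sup>2)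
    = (LINT x|lebesgue_on S. (weak_laplacian S u x
          + 2 * (m - 1) * ((x /\<^sub>R (norm x)\<^sup>2) \<bullet> weak_gradient S u x)
          + (m - 1)\<^sup>2 / (norm x)\<^sup>2 * u x)\<^sup>2)"
  proof -
    have "D [e\<^sub>1, e\<^sub>1] x + D [e\<^sub>2, e\<^sub>2] x + (k 1 x * D [e\<^sub>1] x + k 2 x * D [e\<^sub>2] x) + l x * u x
      = weak_laplacian S u x + 2 * (m - 1) * ((x /\<^sub>R (norm x)\<^sup>2) \<bullet> weak_gradient S u x)
          + (m - 1)\<^sup>2 / (norm x)\<^sup>2 * u x" for x
      by (simp add: wg weak_laplacian_def sum_Basis_plane D_def[symmetric] k_def l_def inner_plane axis_nth
          divide_inverse algebra_simps)
    then show ?thesis by simp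
  qed
  also have "(LINT x|lebesgue_on S. (r x * D [e\<^sub>1] x)\<^sup>2) + (LINT x|lebesgue_on S. (r x * D [e\<^sub>2] x)\<^sup>2)
    = (LINT x|lebesgue_on S. (norm (weak_gradient S u x))\<^sup>2 / (norm x)\<^sup>2)"
  proof -
    have "(norm (weak_gradient S u x))\<^sup>2 = (D [e\<^sub>1] x)\<^sup>2 + (D [e\<^sub>2] x)\<^sup>2" for x
      unfolding power2_norm_eq_inner wg inner_plane by (simp add: axis_nth power2_eq_square)
    then have "(r x * D [e\<^sub>1] x)\<^sup>2 + (r x * D [e\<^sub>2] x)\<^sup>2 = (norm (weak_gradient S u x))\<^sup>2 / (norm x)\<^sup>2" for x
      by (simp add: r_def power_mult_distrib power_divide add_divide_distrib)
    then show ?thesis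
      using Gsq(1)[OF Basis_plane(1)] Gsq(1)[OF Basis_plane(2)]
      by (subst Bochner_Integration.integral_add[symmetric]) auto
  qed
  finally show "((4 * m\<^sup>2 + pi\<^sup>2 / (ln (b / a))\<^sup>2) * (pi\<^sup>2 / (ln (b / a))\<^sup>2))
          / (4 * (m\<^sup>2 + 1) + 2 * pi\<^sup>2 / (ln (b / a))\<^sup>2)
        * (LINT x|lebesgue_on (annulus a b). (norm (weak_gradient (annulus a b) u x))\<^sup>2 / (norm x)\<^sup>2)
      \<le> (LINT x|lebesgue_on (annulus a b).
         (weak_laplacian (annulus a b) u x
          + 2 * (m - 1) * ((x /\<^sub>R (norm x)\<^sup>2) \<bullet> weak_gradient (annulus a b) u x)
          + (m - 1)\<^sup>2 / (norm x)\<^sup>2 * u x)\<^sup>2)"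
    unfolding S_def c_def lam_def by simp
qed

end
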